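(* Let $\mathbb{F}$ be a field of characteristic zero, let $X$ be an $n\times m$ matrix of distinct variables, and let $I_{n,m,r}\subseteq \mathbb{F}[X]$ be the ideal generated by the $r\times r$ minors of $X$. The border multiplicative complexity of any nonzero polynomial in $I_{n,m,r}$ is bounded from below by $\frac{1}{6}\underline{R}(r/4)$, where $\underline{R}(k)$ denotes the border rank of the $k\times k\times k$ matrix multiplication tensor $\langle k,k,k\rangle$.
   Context: An algebraic circuit is a directed acyclic graph whose in-degree-zero gates are labeled by field constants or variables and whose in-degree-two gates are addition or multiplication gates, with edges possibly labeled by field constants scaling the carried value; its multiplicative complexity is its number of multiplication gates. With $\varepsilon$ an indeterminate and "$f + O(\varepsilon)$" meaning $f+\varepsilon g$ for some $g\in\mathbb{F}[X,\varepsilon]$, the border multiplicative complexity of $f\in\mathbb{F}[X]$ is the least $s$ such that some circuit over $\mathbb{F}(\varepsilon)$ with $s$ multiplication gates computes $f + O(\varepsilon)$. The tensor $\langle k,k,k\rangle = \sum_{i,j,l=1}^k x_{i,j}y_{j,l}z_{i,l}$; its border rank is the least $r$ such that there exist linear forms $\ell_{1,j}(x), \ell_{2,j}(y), \ell_{3,j}(z)$ with coefficients in $\mathbb{F}(\varepsilon)$ with $\sum_{j=1}^r \ell_{1,j}\ell_{2,j}\ell_{3,j} = \langle k,k,k\rangle + O(\varepsilon)$. *)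

theory Defs
  imports
    "HOL-Library.Poly_Mapping"
    "HOL-Computational_Algebra.Fraction_Field"
    "HOL-Computational_Algebra.Polynomial"
    "Jordan_Normal_Form.Determinant"
begin

section \<open>Multivariate polynomials\<close>

type_synonym ('v, 'k) mpoly = "('v \<Rightarrow>\<^sub>0 nat) \<Rightarrow>\<^sub>0 'k"

definition Cst :: "'k::zero \<Rightarrow> ('v, 'k) mpoly"
  where "Cst c = Poly_Mapping.single 0 c"

definition Var :: "'v \<Rightarrow> ('v, 'k::zero_neq_one) mpoly"
  where "Var v = Poly_Mapping.single (Poly_Mapping.single v 1) 1"

text \<open>The polynomials in which only variables from \<open>V\<close> occur, i.e. the ring \<open>k[V]\<close>.\<close>

definition polys_in :: "'v set \<Rightarrow> ('v, 'k::zero) mpoly set"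
  where "polys_in V = {p. \<forall>t\<in>Poly_Mapping.keys p. Poly_Mapping.keys t \<subseteq> V}"

definition ideal_gen :: "'v set \<Rightarrow> ('v, 'k::comm_ring_1) mpoly set \<Rightarrow> ('v, 'k) mpoly set"
  where "ideal_gen V S =
    {\<Sum>s\<in>T. c s * s | T c. finite T \<and> T \<subseteq> S \<and> (\<forall>s\<in>T. c s \<in> polys_in V)}"


section \<open>Determinantal ideals\<close>

text \<open>The \<open>n \<times> m\<close> matrix \<open>X\<close> of variables has entries \<open>Var (i, j)\<close>, with indices counted from 0.\<close>

definition matrix_vars :: "nat \<Rightarrow> nat \<Rightarrow> (nat \<times> nat) set"
  where "matrix_vars n m = {..<n} \<times> {..<m}"

definition minors :: "nat \<Rightarrow> nat \<Rightarrow> nat \<Rightarrow> (nat \<times> nat, 'k::comm_ring_1) mpoly set"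
  where "minors n m r =
    {det (mat r r (\<lambda>(a, b). Var (p a, q b))) | p q.
       strict_mono_on {..<r} p \<and> p ` {..<r} \<subseteq> {..<n} \<and>
       strict_mono_on {..<r} q \<and> q ` {..<r} \<subseteq> {..<m}}"

definition det_ideal :: "nat \<Rightarrow> nat \<Rightarrow> nat \<Rightarrow> (nat \<times> nat, 'k::comm_ring_1) mpoly set"
  where "det_ideal n m r = ideal_gen (matrix_vars n m) (minors n m r)"


section \<open>Approximation up to \<open>O(\<epsilon>)\<close>\<close>

text \<open>The field \<open>\<bbbF>(\<epsilon>)\<close> is \<open>'a poly fract\<close>, and \<open>\<bbbF>[X,\<epsilon>]\<close> is rendered as the polynomials in \<open>X\<close>
  with coefficients in \<open>'a poly\<close>.\<close>

definition eps :: "'a::field poly fract"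
  where "eps = Fract [:0, 1:] 1"

definition of_base :: "('v, 'a::field) mpoly \<Rightarrow> ('v, 'a poly fract) mpoly"
  where "of_base = Poly_Mapping.map (\<lambda>c. Fract [:c:] 1)"

definition of_eps_poly :: "('v, 'a::field poly) mpoly \<Rightarrow> ('v, 'a poly fract) mpoly"
  where "of_eps_poly = Poly_Mapping.map (\<lambda>c. Fract c 1)"

text \<open>\<open>approximates V h f\<close> says that \<open>h = f + O(\<epsilon>)\<close>, where \<open>V\<close> is the set of variables.\<close>

definition approximates ::
    "'v set \<Rightarrow> ('v, 'a::field poly fract) mpoly \<Rightarrow> ('v, 'a) mpoly \<Rightarrow> bool"
  where "approximates V h f \<longleftrightarrow>
    (\<exists>g\<in>polys_in V. h = of_base f + Cst eps * of_eps_poly g)"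


section \<open>Algebraic circuits\<close>

text \<open>Gates are named by natural numbers. A gate of in-degree two lists its two incoming edges, each
  given by the scaling constant it carries (1 for an unlabeled edge) and the gate it comes from; the
  two edges may come from the same gate.\<close>

datatype ('v, 'k) gate =
    Const_Gate 'k
  | Var_Gate 'v
  | Add_Gate 'k nat 'k nat
  | Mult_Gate 'k nat 'k nat

fun preds :: "('v, 'k) gate \<Rightarrow> nat set" where
  "preds (Const_Gate c) = {}"
| "preds (Var_Gate v) = {}"
| "preds (Add_Gate a u b w) = {u, w}"
| "preds (Mult_Gate a u b w) = {u, w}"

record ('v, 'k) circuit =
  gates :: "nat set"
  label :: "nat \<Rightarrow> ('v, 'k) gate"
  out_gate :: nat

definition edges :: "('v, 'k) circuit \<Rightarrow> (nat \<times> nat) set"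
  where "edges C = {(u, w). w \<in> gates C \<and> u \<in> preds (label C w)}"

definition circuit_over :: "'v set \<Rightarrow> ('v, 'k) circuit \<Rightarrow> bool"
  where "circuit_over V C \<longleftrightarrow>
    finite (gates C) \<and> out_gate C \<in> gates C \<and>
    (\<forall>w\<in>gates C. preds (label C w) \<subseteq> gates C) \<and>
    (\<forall>w\<in>gates C. \<forall>v. label C w = Var_Gate v \<longrightarrow> v \<in> V) \<and>
    acyclic (edges C)"

fun gate_value :: "(nat \<Rightarrow> ('v, 'k::comm_ring_1) mpoly) \<Rightarrow> ('v, 'k) gate \<Rightarrow> ('v, 'k) mpoly" where
  "gate_value val (Const_Gate c) = Cst c"
| "gate_value val (Var_Gate v) = Var v"
| "gate_value val (Add_Gate a u b w) = Cst a * val u + Cst b * val w"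
| "gate_value val (Mult_Gate a u b w) = (Cst a * val u) * (Cst b * val w)"

text \<open>As a circuit is finite and acyclic, \<open>val\<close> below exists and is unique on its gates.\<close>

definition computes :: "('v, 'k::comm_ring_1) circuit \<Rightarrow> ('v, 'k) mpoly \<Rightarrow> bool"
  where "computes C h \<longleftrightarrow>
    (\<exists>val. (\<forall>w\<in>gates C. val w = gate_value val (label C w)) \<and> val (out_gate C) = h)"

definition mult_complexity :: "('v, 'k) circuit \<Rightarrow> nat"
  where "mult_complexity C = card {w\<in>gates C. \<exists>a u b u'. label C w = Mult_Gate a u b u'}"

definition border_mult_complexity :: "'v set \<Rightarrow> ('v, 'a::field) mpoly \<Rightarrow> nat"
  where "border_mult_complexity V f =
    (LEAST s. \<exists>(C :: ('v, 'a poly fract) circuit) h.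
       circuit_over V C \<and> mult_complexity C = s \<and> computes C h \<and> approximates V h f)"


section \<open>Border rank of matrix multiplication\<close>

datatype mm_var = XV nat nat | YV nat nat | ZV nat nat

definition x_vars :: "nat \<Rightarrow> mm_var set"
  where "x_vars k = {XV i j | i j. i < k \<and> j < k}"

definition y_vars :: "nat \<Rightarrow> mm_var set"
  where "y_vars k = {YV i j | i j. i < k \<and> j < k}"

definition z_vars :: "nat \<Rightarrow> mm_var set"
  where "z_vars k = {ZV i j | i j. i < k \<and> j < k}"

definition matmul_tensor :: "nat \<Rightarrow> (mm_var, 'a::comm_ring_1) mpoly"
  where "matmul_tensor k =
    (\<Sum>i<k. \<Sum>j<k. \<Sum>l<k. Var (XV i j) * Var (YV j l) * Var (ZV i l))"

definition linear_forms :: "'v set \<Rightarrow> ('v, 'k::comm_ring_1) mpoly set"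
  where "linear_forms V = {\<Sum>v\<in>V. Cst (c v) * Var v | c. True}"

text \<open>The first argument only fixes the field \<open>\<bbbF>\<close>.\<close>

definition border_rank_matmul :: "'a::field itself \<Rightarrow> nat \<Rightarrow> nat"
  where "border_rank_matmul _ k =
    (LEAST r. \<exists>l1 l2 l3 :: nat \<Rightarrow> (mm_var, 'a poly fract) mpoly.
       (\<forall>j<r. l1 j \<in> linear_forms (x_vars k) \<and>
              l2 j \<in> linear_forms (y_vars k) \<and>
              l3 j \<in> linear_forms (z_vars k)) \<and>
       approximates (x_vars k \<union> y_vars k \<union> z_vars k)
         (\<Sum>j<r. l1 j * l2 j * l3 j) (matmul_tensor k :: (mm_var, 'a) mpoly))"

end

theory Submission
  imports Defs "HOL-Computational_Algebra.Polynomial_Factorial" "HOL-Library.Countable"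
begin

text \<open>
  Write \<open>f (L D U) = \<Sum> c\<^sub>\<alpha>(L, U) D^\<alpha>\<close> for generic \<open>L\<close>, \<open>U\<close> and a diagonal matrix \<open>D\<close>. As \<open>f\<close> vanishes
  on matrices of rank less than \<open>r\<close>, every monomial \<open>D^\<alpha>\<close> that occurs involves at least \<open>r\<close> variables. If
  \<open>T = diag (\<epsilon>^(a 0), \<epsilon>^(a 1), \<dots>)\<close> with rapidly growing exponents and \<open>M = L\<^sub>0 D\<^sub>0 U\<^sub>0\<close> with \<open>L\<^sub>0\<close>, \<open>U\<^sub>0\<close>
  unitriangular, then \<open>T L\<^sub>0 T\<inverse>\<close> and \<open>T\<inverse> U\<^sub>0 T\<close> are the identity up to \<open>O(\<epsilon>)\<close>, so that
  \<open>f (L T M T U) = \<epsilon>^w (c\<^sub>\<alpha>(L, U) D\<^sub>0^\<alpha> + O(\<epsilon>))\<close> for a single exponent \<open>\<alpha>\<close>. On \<open>3k\<close> of the variables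
  of this \<open>D^\<alpha>\<close>, let \<open>M\<close> be the block matrix with rows \<open>(I, X, 0)\<close>, \<open>(0, I, Y)\<close>, \<open>(Z, 0, I)\<close>: the
  part of \<open>D\<^sub>0^\<alpha>\<close> that is linear in each of \<open>X\<close>, \<open>Y\<close>, \<open>Z\<close> is the trace of \<open>Z X Y\<close> with its diagonal entries
  weighted by exponents \<open>\<alpha>\<^sub>i > 0\<close>, which in characteristic zero can be scaled to \<open>\<langle>k, k, k\<rangle>\<close>.

  In a circuit with \<open>s\<close> multiplications \<open>L\<^sub>g \<cdot> R\<^sub>g\<close>, quadratic parts are linear combinations of products
  of the linear parts of the \<open>L\<^sub>g\<close> and \<open>R\<^sub>g\<close>; collecting the terms that contain a given such product writes
  the cubic part of the output as a sum of \<open>s\<close> products of three linear forms in all variables, hence the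
  trilinear part as a sum of \<open>6 s\<close> products.
\<close>

section \<open>Evaluation of polynomials\<close>

definition eval_monom :: "('v \<Rightarrow> 'b::comm_ring_1) \<Rightarrow> ('v \<Rightarrow>\<^sub>0 nat) \<Rightarrow> 'b"
  where "eval_monom x t = (\<Prod>v\<in>Poly_Mapping.keys t. x v ^ Poly_Mapping.lookup t v)"

text \<open>Keeping the coefficient map \<open>h\<close> as an argument lets one notion cover
  evaluation at points, substitution of polynomials and change of the coefficient ring.\<close>

definition eval_mpoly ::
    "('k::zero \<Rightarrow> 'b) \<Rightarrow> ('v \<Rightarrow> 'b::comm_ring_1) \<Rightarrow> ('v, 'k) mpoly \<Rightarrow> 'b"
  where "eval_mpoly h x p =
    (\<Sum>t\<in>Poly_Mapping.keys p. h (Poly_Mapping.lookup p t) * eval_monom x t)"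

lemma eval_monom_superset:
  assumes "finite S" "Poly_Mapping.keys t \<subseteq> S"
  shows "eval_monom x t = (\<Prod>v\<in>S. x v ^ Poly_Mapping.lookup t v)"
  unfolding eval_monom_def
  by (rule prod.mono_neutral_left) (use assms in \<open>auto simp: in_keys_iff\<close>)

lemma eval_monom_add: "eval_monom x (s + t) = eval_monom x s * eval_monom x t"
proof -
  let ?S = "Poly_Mapping.keys s \<union> Poly_Mapping.keys t"
  have "eval_monom x (s + t) = (\<Prod>v\<in>?S. x v ^ Poly_Mapping.lookup (s + t) v)"
    by (rule eval_monom_superset) (use Poly_Mapping.keys_add[of s t] in auto)
  also have "\<dots> = (\<Prod>v\<in>?S. x v ^ Poly_Mapping.lookup s v) * (\<Prod>v\<in>?S. x v ^ Poly_Mapping.lookup t v)"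
    by (simp add: lookup_add power_add prod.distrib)
  finally show ?thesis
    by (simp add: eval_monom_superset[of ?S])
qed

lemma eval_monom_0 [simp]: "eval_monom x 0 = 1"
  by (simp add: eval_monom_def)

lemma eval_monom_single [simp]: "eval_monom x (Poly_Mapping.single v n) = x v ^ n"
  by (cases "n = 0") (simp_all add: eval_monom_def)

lemma mpoly_eq_sum_single:
  "p = (\<Sum>t\<in>Poly_Mapping.keys p. Poly_Mapping.single t (Poly_Mapping.lookup p t))"
proof (rule poly_mapping_eqI)
  fix t
  show "Poly_Mapping.lookup p t = Poly_Mapping.lookup
      (\<Sum>t\<in>Poly_Mapping.keys p. Poly_Mapping.single t (Poly_Mapping.lookup p t)) t"
    by (auto simp: lookup_sum lookup_single when_def in_keys_iff)
qed

context
  fixes h :: "'k::comm_ring_1 \<Rightarrow> 'b::comm_ring_1" and x :: "'v \<Rightarrow> 'b"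
  assumes h: "comm_ring_hom h"
begin

interpretation h: comm_ring_hom h by (rule h)

lemma eval_mpoly_superset:
  assumes "finite S" "Poly_Mapping.keys p \<subseteq> S"
  shows "eval_mpoly h x p = (\<Sum>t\<in>S. h (Poly_Mapping.lookup p t) * eval_monom x t)"
  unfolding eval_mpoly_def
  by (rule sum.mono_neutral_left) (use assms in \<open>auto simp: in_keys_iff\<close>)

lemma eval_mpoly_add: "eval_mpoly h x (p + q) = eval_mpoly h x p + eval_mpoly h x q"
proof -
  let ?S = "Poly_Mapping.keys p \<union> Poly_Mapping.keys q"
  have "eval_mpoly h x (p + q) =
      (\<Sum>t\<in>?S. h (Poly_Mapping.lookup (p + q) t) * eval_monom x t)"
    by (rule eval_mpoly_superset) (use Poly_Mapping.keys_add[of p q] in auto)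
  then show ?thesis
    by (simp add: lookup_add h.hom_add ring_distribs sum.distrib eval_mpoly_superset[of ?S])
qed

lemma eval_mpoly_0 [simp]: "eval_mpoly h x 0 = 0"
  by (simp add: eval_mpoly_def)

lemma eval_mpoly_sum: "eval_mpoly h x (sum f A) = (\<Sum>a\<in>A. eval_mpoly h x (f a))"
  by (induction A rule: infinite_finite_induct) (simp_all add: eval_mpoly_add)

lemma eval_mpoly_single [simp]: "eval_mpoly h x (Poly_Mapping.single t c) = h c * eval_monom x t"
  by (cases "c = 0") (simp_all add: eval_mpoly_def)

lemma eval_mpoly_Cst [simp]: "eval_mpoly h x (Cst c) = h c"
  by (simp add: Cst_def)

lemma eval_mpoly_Var [simp]: "eval_mpoly h x (Var v) = x v"
  by (simp add: Var_def)

lemma eval_mpoly_mult: "eval_mpoly h x (p * q) = eval_mpoly h x p * eval_mpoly h x q"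
proof -
  let ?m = "\<lambda>p t. Poly_Mapping.single t (Poly_Mapping.lookup p t)"
  have *: "eval_mpoly h x (?m p s * ?m q t) = eval_mpoly h x (?m p s) * eval_mpoly h x (?m q t)" for s t
    by (simp add: mult_single h.hom_mult eval_monom_add mult_ac)
  have "p * q = (\<Sum>s\<in>Poly_Mapping.keys p. \<Sum>t\<in>Poly_Mapping.keys q. ?m p s * ?m q t)"
    by (simp flip: sum_product mpoly_eq_sum_single)
  then have "eval_mpoly h x (p * q) =
      (\<Sum>s\<in>Poly_Mapping.keys p. \<Sum>t\<in>Poly_Mapping.keys q. eval_mpoly h x (?m p s) * eval_mpoly h x (?m q t))"
    by (simp only: eval_mpoly_sum *)
  also have "\<dots> = eval_mpoly h x p * eval_mpoly h x q"
    by (simp flip: sum_product add: eval_mpoly_def[of h x p] eval_mpoly_def[of h x q])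
  finally show ?thesis .
qed

lemma comm_ring_hom_eval_mpoly: "comm_ring_hom (eval_mpoly h x)"
proof
  show "eval_mpoly h x 1 = 1"
    using eval_mpoly_Cst[of 1] by (simp add: Cst_def)
qed (simp_all add: eval_mpoly_add eval_mpoly_mult)

end

section \<open>Ring homomorphisms and composed evaluations\<close>

lemma comm_ring_hom_compose:
  assumes "comm_ring_hom f" "comm_ring_hom g"
  shows "comm_ring_hom (\<lambda>x. g (f x))"
proof -
  interpret f: comm_ring_hom f by fact
  interpret g: comm_ring_hom g by fact
  show ?thesis by standard (simp_all add: f.hom_mult f.hom_add g.hom_mult g.hom_add)
qed

lemma comm_ring_hom_const_poly: "comm_ring_hom (\<lambda>c. [:c:])"
  by standard (simp_all add: one_pCons)

lemma comm_ring_hom_Cst: "comm_ring_hom Cst"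
  by standard (simp_all add: Cst_def single_add mult_single)

lemma hom_eval_mpoly:
  assumes "comm_ring_hom g"
  shows "g (eval_mpoly h x p) = eval_mpoly (\<lambda>c. g (h c)) (\<lambda>v. g (x v)) p"
proof -
  interpret g: comm_ring_hom g by fact
  show ?thesis
    by (simp add: eval_mpoly_def eval_monom_def hom_distribs)
qed

lemma eval_mpoly_eval_mpoly:
  assumes "comm_ring_hom g"
  shows "eval_mpoly g y (eval_mpoly h x p) =
    eval_mpoly (\<lambda>c. eval_mpoly g y (h c)) (\<lambda>v. eval_mpoly g y (x v)) p"
  by (rule hom_eval_mpoly) (rule comm_ring_hom_eval_mpoly[OF assms])

lemma lookup_map_mpoly: "c 0 = 0 \<Longrightarrow> Poly_Mapping.lookup (Poly_Mapping.map c p) t = c (Poly_Mapping.lookup p t)"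
  by transfer (auto simp: when_def)

lemma eval_mpoly_map:
  assumes "c 0 = 0" "h 0 = 0"
  shows "eval_mpoly h x (Poly_Mapping.map c p) = eval_mpoly (\<lambda>a. h (c a)) x p"
proof -
  note l = lookup_map_mpoly[of c, OF assms(1)]
  have "Poly_Mapping.keys (Poly_Mapping.map c p) \<subseteq> Poly_Mapping.keys p"
    by (auto simp: in_keys_iff l assms(1))
  then show ?thesis
    unfolding eval_mpoly_def l
    by (intro sum.mono_neutral_left) (auto simp: in_keys_iff l assms)
qed

section \<open>Setting variables to zero\<close>

lemma eval_monom_Var:
  "eval_monom (\<lambda>v. if v \<in> S then Var v else 0) t =
    (if Poly_Mapping.keys t \<subseteq> S then Poly_Mapping.single t (1::'k::comm_ring_1) else 0)"
proof (cases "Poly_Mapping.keys t \<subseteq> S")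
  case True
  have V: "(Var v :: ('a, 'k) mpoly) ^ n = Poly_Mapping.single (Poly_Mapping.single v n) 1" for v n
    by (induction n) (simp_all add: Var_def mult_single flip: single_add)
  have P: "(\<Prod>v\<in>A. Poly_Mapping.single (g v) (1::'k)) = Poly_Mapping.single (sum g A) 1"
    if "finite A" for A and g :: "'a \<Rightarrow> 'a \<Rightarrow>\<^sub>0 nat"
    using that by (induction A rule: finite_induct) (simp_all add: mult_single)
  have "eval_monom (\<lambda>v. if v \<in> S then Var v else 0) t = (\<Prod>v\<in>Poly_Mapping.keys t. Poly_Mapping.single
      (Poly_Mapping.single v (Poly_Mapping.lookup t v)) (1::'k))"
    unfolding eval_monom_def by (rule prod.cong) (use True in \<open>auto simp: V\<close>)
  also have "\<dots> = Poly_Mapping.single t 1"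
    by (simp add: P flip: mpoly_eq_sum_single)
  finally show ?thesis using True by simp
next
  case False
  then obtain v where "v \<in> Poly_Mapping.keys t" "v \<notin> S" by auto
  then have "eval_monom (\<lambda>v. if v \<in> S then Var v else 0) t = 0"
    unfolding eval_monom_def by (intro prod_zero) (auto simp: in_keys_iff power_0_left intro!: bexI[of _ v])
  with False show ?thesis by simp
qed

text \<open>Serves two purposes: it describes \<open>polys_in V\<close> as the fixed points of a
  ring homomorphism, and it later isolates the terms that involve few entries of the diagonal matrix
  D.\<close>

lemma lookup_eval_mpoly_restrict:
  "Poly_Mapping.lookup (eval_mpoly Cst (\<lambda>v. if v \<in> S then Var v else 0) p) t =
    (if Poly_Mapping.keys t \<subseteq> S then Poly_Mapping.lookup (p :: ('v, 'k::comm_ring_1) mpoly) t else 0)"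
proof -
  have "eval_mpoly Cst (\<lambda>v. if v \<in> S then Var v else 0) p =
     (\<Sum>t\<in>Poly_Mapping.keys p. if Poly_Mapping.keys t \<subseteq> S then Poly_Mapping.single t (Poly_Mapping.lookup p t) else 0)"
    unfolding eval_mpoly_def eval_monom_Var
    by (rule sum.cong) (auto simp: Cst_def mult_single)
  then have "Poly_Mapping.lookup (eval_mpoly Cst (\<lambda>v. if v \<in> S then Var v else 0) p) t =
      (\<Sum>s\<in>Poly_Mapping.keys p. if s = t then if Poly_Mapping.keys t \<subseteq> S then Poly_Mapping.lookup p t else 0 else 0)"
    by (auto simp only: lookup_sum intro!: sum.cong) (auto simp: lookup_single when_def)
  then show ?thesis
    by (simp add: sum.delta in_keys_iff)
qed

lemma polys_in_iff_eval_mpoly: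
  "p \<in> polys_in V \<longleftrightarrow> eval_mpoly Cst (\<lambda>v. if v \<in> V then Var v else 0) p = (p :: ('v, 'k::comm_ring_1) mpoly)"
  by (auto simp: polys_in_def poly_mapping_eq_iff fun_eq_iff lookup_eval_mpoly_restrict in_keys_iff split: if_splits)

lemma eval_mpoly_Cst_Var: "eval_mpoly Cst Var p = (p :: ('v, 'k::comm_ring_1) mpoly)"
  using polys_in_iff_eval_mpoly[of p UNIV] by (simp add: polys_in_def)

text \<open>A member of \<open>polys_in V\<close> equals its own evaluation at the variables of
  \<open>V\<close> and zero, an expression built from constants, variables, sums and products
  only.\<close>

lemma polys_in_induct [consumes 1, case_names Cst Var add mult]:
  assumes "p \<in> polys_in V"
    and C: "\<And>c. P (Cst c)" and V: "\<And>v. v \<in> V \<Longrightarrow> P (Var v)"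
    and A: "\<And>p q. P p \<Longrightarrow> P q \<Longrightarrow> P (p + q)" and M: "\<And>p q. P p \<Longrightarrow> P q \<Longrightarrow> P (p * q)"
  shows "P (p :: ('v, 'k::comm_ring_1) mpoly)"
proof -
  interpret Cst: comm_ring_hom "Cst :: 'k \<Rightarrow> ('v, 'k) mpoly" by (rule comm_ring_hom_Cst)
  have P0: "P 0" and P1: "P 1" using C[of 0] C[of 1] by simp_all
  let ?x = "\<lambda>v. if v \<in> V then Var v else (0 :: ('v, 'k) mpoly)"
  have pw: "P q \<Longrightarrow> P (q ^ n)" for q n by (induction n) (auto intro: P1 M)
  have "P (eval_monom ?x t)" for t
  proof -
    have "P (\<Prod>v\<in>A. ?x v ^ Poly_Mapping.lookup t v)" for A
      by (induction A rule: infinite_finite_induct) (auto intro!: P1 P0 M pw V simp del: prod_power_distrib simp: power_0_left)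
    then show ?thesis unfolding eval_monom_def .
  qed
  then have "P (\<Sum>t\<in>A. Cst (Poly_Mapping.lookup p t) * eval_monom ?x t)" for A
    by (induction A rule: infinite_finite_induct) (auto intro!: P0 A M C)
  then have "P (eval_mpoly Cst ?x p)" unfolding eval_mpoly_def .
  with assms(1) show ?thesis by (simp add: polys_in_iff_eval_mpoly)
qed

lemma polys_in_add: "p \<in> polys_in V \<Longrightarrow> q \<in> polys_in V \<Longrightarrow> p + q \<in> polys_in V"
  and polys_in_mult: "p \<in> polys_in V \<Longrightarrow> q \<in> polys_in V \<Longrightarrow> p * q \<in> polys_in V"
  and polys_in_Cst: "Cst c \<in> (polys_in V :: ('v, 'k) mpoly set)"
  and polys_in_Var: "v \<in> V \<Longrightarrow> Var v \<in> (polys_in V :: ('v, 'k) mpoly set)"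
  for p q :: "('v, 'k::comm_ring_1) mpoly"
  by (simp_all add: polys_in_iff_eval_mpoly eval_mpoly_add eval_mpoly_mult comm_ring_hom_Cst)

lemma polys_in_sum: "(\<And>a. a \<in> A \<Longrightarrow> f a \<in> polys_in V) \<Longrightarrow> sum f A \<in> polys_in V"
  for f :: "'a \<Rightarrow> ('v, 'k::comm_ring_1) mpoly"
  by (induction A rule: infinite_finite_induct) (simp_all add: polys_in_add, simp_all add: polys_in_def)

section \<open>Determinantal ideals and matrices of low rank\<close>

lemma det_ideal_subset_polys_in: "det_ideal n m r \<subseteq> polys_in (matrix_vars n m)"
proof
  fix f :: "(nat \<times> nat, 'k::comm_ring_1) mpoly" assume "f \<in> det_ideal n m r"
  then obtain T c where f: "f = (\<Sum>s\<in>T. c s * s)" and T: "T \<subseteq> minors n m r"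
    and c: "\<forall>s\<in>T. c s \<in> polys_in (matrix_vars n m)"
    by (auto simp: det_ideal_def ideal_gen_def)
  let ?x = "\<lambda>v. if v \<in> matrix_vars n m then Var v else (0 :: (nat \<times> nat, 'k) mpoly)"
  interpret H: comm_ring_hom "eval_mpoly Cst ?x"
    by (intro comm_ring_hom_eval_mpoly comm_ring_hom_Cst)
  have "s \<in> polys_in (matrix_vars n m)" if "s \<in> T" for s
  proof -
    from that T obtain p q where s: "s = det (mat r r (\<lambda>(a, b). Var (p a, q b)))"
      and pq: "p ` {..<r} \<subseteq> {..<n}" "q ` {..<r} \<subseteq> {..<m}"
      by (auto simp: minors_def)
    have "map_mat (eval_mpoly Cst ?x) (mat r r (\<lambda>(a, b). Var (p a, q b))) = mat r r (\<lambda>(a, b). Var (p a, q b))"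
      by (rule eq_matI) (use pq in \<open>auto simp: comm_ring_hom_Cst matrix_vars_def\<close>)
    then show ?thesis unfolding polys_in_iff_eval_mpoly s by (simp flip: H.hom_det)
  qed
  with c show "f \<in> polys_in (matrix_vars n m)"
    unfolding f by (intro polys_in_sum polys_in_mult) auto
qed

text \<open>The matrix factors through fewer than \<open>r\<close> indices. Padding both factors to
  size \<open>r\<close> leaves a zero row in the second one, so multiplicativity of the determinant
  settles the claim over any commutative ring.\<close>

lemma det_rank_deficient:
  fixes A :: "nat \<Rightarrow> 'i \<Rightarrow> 'b::comm_ring_1"
  assumes "finite S" "card S < r"
  shows "det (mat r r (\<lambda>(a, b). \<Sum>i\<in>S. A a i * B i b)) = 0"
proof -
  obtain \<sigma> where \<sigma>: "bij_betw \<sigma> {0..<card S} S"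
    using ex_bij_betw_nat_finite[OF assms(1)] by blast
  let ?A = "mat r r (\<lambda>(a, t). if t < card S then A a (\<sigma> t) else 0)"
  let ?B = "mat\<^sub>r r r (\<lambda>t. if t = r - 1 then 0\<^sub>v r else vec r (\<lambda>b. B (\<sigma> t) b))"
  have "mat r r (\<lambda>(a, b). \<Sum>i\<in>S. A a i * B i b) = ?A * ?B"
  proof (rule eq_matI)
    fix a b assume ab: "a < dim_row (?A * ?B)" "b < dim_col (?A * ?B)"
    have "(\<Sum>i\<in>S. A a i * B i b) = (\<Sum>t\<in>{0..<card S}. A a (\<sigma> t) * B (\<sigma> t) b)"
      by (rule sum.reindex_bij_betw[OF \<sigma>, symmetric])
    also have "\<dots> = (\<Sum>t\<in>{0..<r}. (if t < card S then A a (\<sigma> t) else 0) *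
        (if t = r - 1 then 0 else B (\<sigma> t) b))"
      by (rule sum.mono_neutral_cong_left) (use assms(2) in auto)
    finally show "mat r r (\<lambda>(a, b). \<Sum>i\<in>S. A a i * B i b) $$ (a, b) = (?A * ?B) $$ (a, b)"
      using ab by (auto simp: scalar_prod_def mat_of_rows_def intro!: sum.cong)
  qed auto
  moreover have "det ?B = 0"
    by (rule det_row_0) (use assms in auto)
  moreover have "det (?A * ?B) = det ?A * det ?B"
    by (rule det_mult) auto
  ultimately show ?thesis by simp
qed

text \<open>Evaluation commutes with determinants, so each generator becomes a minor of a product
  that factors through \<open>S\<close>. A general target ring allows the factors to be generic
  matrices.\<close>

lemma det_ideal_eval_eq_0:
  fixes f :: "(nat \<times> nat, 'k::comm_ring_1) mpoly" and A :: "nat \<Rightarrow> 'i \<Rightarrow> 'b::comm_ring_1"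
  assumes "f \<in> det_ideal n m r" "comm_ring_hom h" "finite S" "card S < r"
  shows "eval_mpoly h (\<lambda>(i, j). \<Sum>t\<in>S. A i t * B t j) f = 0"
proof -
  let ?x = "\<lambda>(i, j). \<Sum>t\<in>S. A i t * B t j"
  interpret H: comm_ring_hom "eval_mpoly h ?x"
    by (rule comm_ring_hom_eval_mpoly) fact
  obtain T c where f: "f = (\<Sum>s\<in>T. c s * s)" and T: "T \<subseteq> minors n m r"
    using assms(1) by (auto simp: det_ideal_def ideal_gen_def)
  have "eval_mpoly h ?x s = 0" if "s \<in> T" for s
  proof -
    from that T obtain p q where s: "s = det (mat r r (\<lambda>(a, b). Var (p a, q b)))"
      by (auto simp: minors_def)
    have "map_mat (eval_mpoly h ?x) (mat r r (\<lambda>(a, b). Var (p a, q b))) =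
        mat r r (\<lambda>(a, b). \<Sum>t\<in>S. A (p a) t * B t (q b))"
      by (rule eq_matI) (auto simp: assms(2))
    then show ?thesis
      unfolding s by (simp flip: H.hom_det add: det_rank_deficient[OF assms(3,4)])
  qed
  then show ?thesis unfolding f by (simp add: hom_distribs)
qed

section \<open>Weights separating monomials\<close>

lemma base_digits_unique:
  fixes f g :: "nat \<Rightarrow> nat"
  assumes "\<forall>i<n. f i < B \<and> g i < B" "(\<Sum>i<n. f i * B ^ i) = (\<Sum>i<n. g i * B ^ i)" "i < n"
  shows "f i = g i"
  using assms
proof (induction n arbitrary: f g i)
  case (Suc n)
  let ?s = "\<lambda>f. \<Sum>i<n. f (Suc i) * B ^ i"
  have split: "(\<Sum>i<Suc n. f i * B ^ i) = f 0 + B * ?s f" for f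
    unfolding sum.lessThan_Suc_shift by (simp add: sum_distrib_left mult_ac)
  have eq: "f 0 + B * ?s f = g 0 + B * ?s g"
    using Suc.prems(2) unfolding split .
  have B: "f 0 < B" "g 0 < B" using Suc.prems(1) by auto
  have "f 0 = (f 0 + B * ?s f) mod B" using B by simp
  also have "\<dots> = g 0" unfolding eq using B by simp
  finally have 0: "f 0 = g 0" .
  with eq B have s: "?s f = ?s g" by simp
  show ?case
  proof (cases i)
    case (Suc j)
    then show ?thesis
      using Suc.IH[of "\<lambda>i. f (Suc i)" "\<lambda>i. g (Suc i)" j] s Suc.prems(1,3) by simp
  qed (simp add: 0)
qed simp

definition weight :: "('v \<Rightarrow> nat) \<Rightarrow> ('v \<Rightarrow>\<^sub>0 nat) \<Rightarrow> nat"
  where "weight w t = (\<Sum>v\<in>Poly_Mapping.keys t. w v * Poly_Mapping.lookup t v)"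

lemma weight_superset:
  assumes "finite S" "Poly_Mapping.keys t \<subseteq> S"
  shows "weight w t = (\<Sum>v\<in>S. w v * Poly_Mapping.lookup t v)"
  unfolding weight_def
  by (rule sum.mono_neutral_left) (use assms in \<open>auto simp: in_keys_iff\<close>)

lemma eval_monom_power: "eval_monom (\<lambda>v. z ^ w v) t = z ^ weight w t"
  by (simp add: eval_monom_def weight_def power_sum power_mult)

text \<open>Kronecker substitution: once \<open>B\<close> exceeds all exponents in \<open>T\<close>,
  the weight of a monomial is a number whose base-\<open>B\<close> digits are its exponents, with
  one digit position per variable.\<close>

lemma separating_base:
  fixes idx :: "'v \<Rightarrow> nat"
  assumes "finite T" "inj idx"
  obtains B where "B \<ge> 2" "inj_on (weight (\<lambda>v. B ^ idx v)) T"
proof -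
  define W where "W = (\<Union>t\<in>T. Poly_Mapping.keys t)"
  have W: "finite W" using assms(1) by (simp add: W_def)
  \<comment> \<open>The summand 2 makes the powers of \<open>B\<close> strictly increasing, as
    needed later for the exponents of the matrix T.\<close>
  define B where "B = 2 + (\<Sum>t\<in>T. \<Sum>v\<in>W. Poly_Mapping.lookup t v)"
  obtain n where n: "idx ` W \<subseteq> {..<n}"
    using W finite_nat_iff_bounded finite_imageI by meson
  have le: "Poly_Mapping.lookup t v < B" if "t \<in> T" for t v
  proof (cases "v \<in> W")
    case True
    have "Poly_Mapping.lookup t v \<le> (\<Sum>v\<in>W. Poly_Mapping.lookup t v)"
      using W True by (intro member_le_sum) auto
    also have "\<dots> \<le> (\<Sum>t\<in>T. \<Sum>v\<in>W. Poly_Mapping.lookup t v)"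
      by (rule member_le_sum[OF that, of "\<lambda>t. \<Sum>v\<in>W. Poly_Mapping.lookup t v"]) (use assms in auto)
    finally show ?thesis by (simp add: B_def)
  next
    case False
    with that have "Poly_Mapping.lookup t v = 0" by (auto simp: W_def in_keys_iff)
    then show ?thesis by (simp add: B_def)
  qed
  define d where "d t i = (if i \<in> idx ` W then Poly_Mapping.lookup t (inv_into UNIV idx i) else 0)"
    for t :: "'v \<Rightarrow>\<^sub>0 nat" and i
  have wt: "weight (\<lambda>v. B ^ idx v) t = (\<Sum>i<n. d t i * B ^ i)" if "t \<in> T" for t
  proof -
    have "weight (\<lambda>v. B ^ idx v) t = (\<Sum>v\<in>W. B ^ idx v * Poly_Mapping.lookup t v)"
      by (rule weight_superset) (use W that in \<open>auto simp: W_def\<close>)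
    also have "\<dots> = (\<Sum>i\<in>idx ` W. d t i * B ^ i)"
      by (subst sum.reindex) (use assms(2) in \<open>auto simp: d_def inj_on_def inv_f_f[OF assms(2)] mult.commute\<close>)
    also have "\<dots> = (\<Sum>i<n. d t i * B ^ i)"
      by (rule sum.mono_neutral_left) (use n in \<open>auto simp: d_def\<close>)
    finally show ?thesis .
  qed
  have "inj_on (weight (\<lambda>v. B ^ idx v)) T"
  proof (rule inj_onI, rule poly_mapping_eqI)
    fix s t v assume st: "s \<in> T" "t \<in> T" "weight (\<lambda>v. B ^ idx v) s = weight (\<lambda>v. B ^ idx v) t"
    show "Poly_Mapping.lookup s v = Poly_Mapping.lookup t v"
    proof (cases "v \<in> W")
      case True
      then have "idx v < n" using n by auto
      then have "d s (idx v) = d t (idx v)"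
        using st le by (intro base_digits_unique[of n "d s" B "d t"]) (auto simp: wt d_def, auto simp: B_def)
      then show ?thesis using True by (simp add: d_def inv_f_f[OF assms(2)])
    qed (use st in \<open>auto simp: W_def in_keys_iff\<close>)
  qed
  with that[of B] show ?thesis by (simp add: B_def)
qed

text \<open>Substituting suitable powers of one variable keeps all monomials of \<open>p\<close> distinct.\<close>

lemma exists_eval_mpoly_nonzero:
  fixes p :: "('v::countable, 'k::field_char_0) mpoly"
  assumes "p \<noteq> 0"
  shows "\<exists>x. eval_mpoly (\<lambda>c. c) x p \<noteq> 0"
proof -
  obtain B where B: "inj_on (weight (\<lambda>v. B ^ to_nat (v :: 'v))) (Poly_Mapping.keys p)"
    by (rule separating_base[of "Poly_Mapping.keys p" "to_nat :: 'v \<Rightarrow> nat"]) auto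
  define w where "w = weight (\<lambda>v :: 'v. B ^ to_nat v)"
  define q where "q = (\<Sum>t\<in>Poly_Mapping.keys p. monom (Poly_Mapping.lookup p t) (w t))"
  obtain t where t: "t \<in> Poly_Mapping.keys p"
    using assms by (metis poly_mapping_eqI in_keys_iff lookup_zero)
  have "coeff q (w t) = (\<Sum>s\<in>Poly_Mapping.keys p. if s = t then Poly_Mapping.lookup p t else 0)"
    unfolding q_def coeff_sum
    by (rule sum.cong) (use t B in \<open>auto simp: w_def inj_on_def\<close>)
  also have "\<dots> \<noteq> 0" using t by (simp add: in_keys_iff)
  finally have "q \<noteq> 0" by auto
  \<comment> \<open>A field of characteristic zero is infinite, so some point is not a root of
    \<open>q\<close>.\<close>
  then have "finite {z. poly q z = 0}" by (rule poly_roots_finite)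
  then obtain z where z: "poly q z \<noteq> 0"
    using infinite_UNIV_char_0[where 'a='k] by (metis (mono_tags, lifting) UNIV_I finite_subset mem_Collect_eq subsetI)
  have "eval_mpoly (\<lambda>c. c) (\<lambda>v. z ^ (B ^ to_nat v)) p = poly q z"
    by (simp add: eval_mpoly_def eval_monom_power q_def w_def poly_sum poly_monom)
  with z show ?thesis by metis
qed

section \<open>Dual numbers\<close>

text \<open>\<open>Dual a b\<close> stands for a + b e with e^2 = 0. Three nested layers record the
  dependence of a value on three independent first-order perturbations.\<close>

datatype 'a dual = Dual (std: 'a) (tangent: 'a)

instantiation dual :: (comm_ring_1) comm_ring_1
begin

definition "0 = Dual 0 0"
definition "1 = Dual 1 0"
definition "x + y = Dual (std x + std y) (tangent x + tangent y)"
definition "x - y = Dual (std x - std y) (tangent x - tangent y)"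
definition "- x = Dual (- std x) (- tangent x)"
definition "x * y = Dual (std x * std y) (std x * tangent y + tangent x * std y)"

instance
  by standard
    (auto simp: zero_dual_def one_dual_def plus_dual_def minus_dual_def uminus_dual_def
      times_dual_def algebra_simps intro: dual.expand)

end

lemma dual_sel [simp]:
  "std 0 = 0" "tangent 0 = 0" "std 1 = 1" "tangent 1 = 0"
  "std (x + y) = std x + std y" "tangent (x + y) = tangent x + tangent y"
  "std (x - y) = std x - std y" "tangent (x - y) = tangent x - tangent y"
  "std (- x) = - std x" "tangent (- x) = - tangent x"
  "std (x * y) = std x * std y" "tangent (x * y) = std x * tangent y + tangent x * std y"
  by (simp_all add: zero_dual_def one_dual_def plus_dual_def minus_dual_def uminus_dual_def
      times_dual_def)

lemma comm_ring_hom_map_dual: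
  assumes "comm_ring_hom h"
  shows "comm_ring_hom (map_dual h)"
proof -
  interpret comm_ring_hom h by fact
  show ?thesis
    by standard (auto simp: hom_distribs dual.map_sel intro!: dual.expand)
qed

text \<open>The algebra \<open>k[e\<^sub>1, e\<^sub>2, e\<^sub>3] / (e\<^sub>1\<^sup>2, e\<^sub>2\<^sup>2, e\<^sub>3\<^sup>2)\<close>.\<close>

type_synonym 'a dual3 = "'a dual dual dual"

definition scalar :: "'a::comm_ring_1 \<Rightarrow> 'a dual3"
  where "scalar c = Dual (Dual (Dual c 0) 0) 0"

definition map3 :: "('a \<Rightarrow> 'b) \<Rightarrow> 'a dual3 \<Rightarrow> 'b dual3"
  where "map3 h = map_dual (map_dual (map_dual h))"

definition e1 :: "'a::comm_ring_1 dual3" where "e1 = Dual (Dual (Dual 0 1) 0) 0"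
definition e2 :: "'a::comm_ring_1 dual3" where "e2 = Dual (Dual 0 1) 0"
definition e3 :: "'a::comm_ring_1 dual3" where "e3 = Dual 0 1"

text \<open>Coordinates in the basis of square-free monomials in \<open>e1\<close>,
  \<open>e2\<close>, \<open>e3\<close>: the innermost layer belongs to \<open>e1\<close>, the
  outermost to \<open>e3\<close>.\<close>

definition "c0 x = std (std (std x))"
definition "c1 x = tangent (std (std x))"
definition "c2 x = std (tangent (std x))"
definition "c3 x = std (std (tangent x))"
definition "c12 x = tangent (tangent (std x))"
definition "c13 x = tangent (std (tangent x))"
definition "c23 x = std (tangent (tangent x))"
definition "c123 x = tangent (tangent (tangent x))"

lemmas coord_defs = c0_def c1_def c2_def c3_def c12_def c13_def c23_def c123_def

lemma coord_add [simp]: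
  "c0 (x + y) = c0 x + c0 y" "c1 (x + y) = c1 x + c1 y" "c2 (x + y) = c2 x + c2 y"
  "c3 (x + y) = c3 x + c3 y" "c12 (x + y) = c12 x + c12 y" "c13 (x + y) = c13 x + c13 y"
  "c23 (x + y) = c23 x + c23 y" "c123 (x + y) = c123 x + c123 y"
  by (simp_all add: coord_defs)

text \<open>Terms with a factor \<open>c0\<close> come first; the remaining terms of
  \<open>c12\<close>, \<open>c13\<close>, \<open>c23\<close> and \<open>c123\<close> are what a
  multiplication gate newly contributes.\<close>

lemma coord_mult:
  "c0 (x * y) = c0 x * c0 y"
  "c1 (x * y) = c0 x * c1 y + c1 x * c0 y"
  "c2 (x * y) = c0 x * c2 y + c2 x * c0 y"
  "c3 (x * y) = c0 x * c3 y + c3 x * c0 y"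
  "c12 (x * y) = c0 x * c12 y + c12 x * c0 y + (c1 x * c2 y + c2 x * c1 y)"
  "c13 (x * y) = c0 x * c13 y + c13 x * c0 y + (c1 x * c3 y + c3 x * c1 y)"
  "c23 (x * y) = c0 x * c23 y + c23 x * c0 y + (c2 x * c3 y + c3 x * c2 y)"
  "c123 (x * y) = c0 x * c123 y + c123 x * c0 y +
    (c1 x * c23 y + c23 x * c1 y + c2 x * c13 y + c13 x * c2 y + c3 x * c12 y + c12 x * c3 y)"
  by (simp_all add: coord_defs algebra_simps)

lemma coord_scalar [simp]:
  "c0 (scalar a) = a" "c1 (scalar a) = 0" "c2 (scalar a) = 0" "c3 (scalar a) = 0"
  "c12 (scalar a) = 0" "c13 (scalar a) = 0" "c23 (scalar a) = 0" "c123 (scalar a) = 0"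
  by (simp_all add: coord_defs scalar_def)

lemma coord_e [simp]:
  "c0 e1 = 0" "c1 e1 = 1" "c2 e1 = 0" "c3 e1 = 0" "c12 e1 = 0" "c13 e1 = 0" "c23 e1 = 0" "c123 e1 = 0"
  "c0 e2 = 0" "c1 e2 = 0" "c2 e2 = 1" "c3 e2 = 0" "c12 e2 = 0" "c13 e2 = 0" "c23 e2 = 0" "c123 e2 = 0"
  "c0 e3 = 0" "c1 e3 = 0" "c2 e3 = 0" "c3 e3 = 1" "c12 e3 = 0" "c13 e3 = 0" "c23 e3 = 0" "c123 e3 = 0"
  by (simp_all add: coord_defs e1_def e2_def e3_def)

lemma e_squares [simp]: "e1 * e1 = 0" "e2 * e2 = 0" "e3 * e3 = 0"
  by (auto simp: e1_def e2_def e3_def intro!: dual.expand)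

lemma comm_ring_hom_scalar: "comm_ring_hom scalar"
  by standard (auto simp: scalar_def intro!: dual.expand)

lemma comm_ring_hom_map3: "comm_ring_hom h \<Longrightarrow> comm_ring_hom (map3 h)"
  unfolding map3_def by (intro comm_ring_hom_map_dual)

lemma map3_scalar [simp]: "h 0 = 0 \<Longrightarrow> map3 h (scalar a) = scalar (h a)"
  by (simp add: map3_def scalar_def zero_dual_def)

lemma map3_e:
  assumes "h 0 = 0" "h 1 = 1"
  shows "map3 h e1 = e1" "map3 h e2 = e2" "map3 h e3 = e3"
  by (simp_all add: map3_def e1_def e2_def e3_def zero_dual_def one_dual_def assms)

lemma c123_map3 [simp]: "c123 (map3 h x) = h (c123 x)"
  by (simp add: map3_def c123_def dual.map_sel)

section \<open>Substituting a power of the indeterminate\<close>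

text \<open>Replaces \<epsilon> by \<epsilon>^N in an arbitrarily chosen representing fraction; by
  \<open>subst_eps_Fract\<close> the choice is immaterial for \<open>N > 0\<close>.\<close>

definition subst_eps :: "nat \<Rightarrow> 'a::field poly fract \<Rightarrow> 'a poly fract"
  where "subst_eps N x =
    (let (a, b) = SOME (a, b). b \<noteq> 0 \<and> x = Fract a b
     in Fract (pcompose a (monom 1 N)) (pcompose b (monom 1 N)))"

lemma pcompose_monom_eq_0_iff:
  assumes "N > 0"
  shows "pcompose b (monom 1 N) = 0 \<longleftrightarrow> b = (0 :: 'a::field poly)"
  using assms by (simp add: pcompose_eq_0_iff degree_monom_eq)

lemma subst_eps_Fract:
  assumes "N > 0" "b \<noteq> 0"
  shows "subst_eps N (Fract a b) = Fract (pcompose a (monom 1 N)) (pcompose b (monom 1 N))"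
proof -
  let ?P = "\<lambda>(a', b'). b' \<noteq> 0 \<and> Fract a b = Fract a' b'"
  obtain a' b' where ab: "(SOME ab. ?P ab) = (a', b')" by fastforce
  have "?P (SOME ab. ?P ab)"
    by (rule someI[of ?P "(a, b)"]) (use assms in auto)
  then have *: "b' \<noteq> 0" "a * b' = a' * b" using assms unfolding ab by (auto simp: eq_fract)
  \<comment> \<open>Equality of fractions is a polynomial identity after cross-multiplication, and
    composition preserves it.\<close>
  have "pcompose a (monom 1 N) * pcompose b' (monom 1 N) = pcompose a' (monom 1 N) * pcompose b (monom 1 N)"
    by (simp flip: pcompose_mult add: *)
  then show ?thesis
    unfolding subst_eps_def ab Let_def
    using assms * by (simp add: eq_fract pcompose_monom_eq_0_iff)
qed

lemma comm_ring_hom_subst_eps: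
  assumes "N > 0"
  shows "comm_ring_hom (subst_eps N :: 'a::field poly fract \<Rightarrow> _)"
proof
  fix x y :: "'a poly fract"
  obtain a b where x: "x = Fract a b" "b \<noteq> 0" by (cases x) auto
  obtain c d where y: "y = Fract c d" "d \<noteq> 0" by (cases y) auto
  have nz: "pcompose b (monom 1 N) \<noteq> 0" "pcompose d (monom 1 N) \<noteq> 0"
    using x y assms by (simp_all add: pcompose_monom_eq_0_iff)
  show "subst_eps N (x * y) = subst_eps N x * subst_eps N y"
    "subst_eps N (x + y) = subst_eps N x + subst_eps N y"
    unfolding x y using x y assms nz by (simp_all add: subst_eps_Fract pcompose_mult pcompose_add)
next
  show "subst_eps N (0 :: 'a poly fract) = 0" "subst_eps N (1 :: 'a poly fract) = 1"
    using assms by (simp_all add: Zero_fract_def One_fract_def subst_eps_Fract pcompose_1)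
qed

lemma subst_eps_to_fract: "N > 0 \<Longrightarrow> subst_eps N (to_fract p) = to_fract (pcompose p (monom 1 N))"
  by (simp add: to_fract_def subst_eps_Fract pcompose_1)

section \<open>Circuits\<close>

lemma gate_value_cong:
  "(\<And>u. u \<in> preds g \<Longrightarrow> f u = f' u) \<Longrightarrow> gate_value f g = gate_value f' g"
  by (cases g) auto

text \<open>A circuit in topological order together with its gate values. Appending gates leaves all
  earlier indices valid.\<close>

definition straight_line ::
    "'v set \<Rightarrow> ('v, 'k::comm_ring_1) gate list \<Rightarrow> ('v, 'k) mpoly list \<Rightarrow> bool"
  where "straight_line V gs vs \<longleftrightarrow> length vs = length gs \<and>
    (\<forall>i<length gs. preds (gs ! i) \<subseteq> {..<i} \<and> (\<forall>v. gs ! i = Var_Gate v \<longrightarrow> v \<in> V) \<and>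
      vs ! i = gate_value ((!) vs) (gs ! i))"

lemma straight_line_snoc:
  assumes "straight_line V gs vs" "preds g \<subseteq> {..<length gs}" "\<forall>v. g = Var_Gate v \<longrightarrow> v \<in> V"
  shows "straight_line V (gs @ [g]) (vs @ [gate_value ((!) vs) g])"
  unfolding straight_line_def
proof (intro conjI allI impI)
  fix i assume i: "i < length (gs @ [g])"
  have len: "length vs = length gs" using assms(1) by (simp add: straight_line_def)
  show "preds ((gs @ [g]) ! i) \<subseteq> {..<i}"
    using assms i by (cases "i = length gs") (auto simp: straight_line_def nth_append)
  have "gate_value ((!) (vs @ [gate_value ((!) vs) g])) ((gs @ [g]) ! i) = gate_value ((!) vs) ((gs @ [g]) ! i)"
    using \<open>preds ((gs @ [g]) ! i) \<subseteq> {..<i}\<close> i len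
    by (intro gate_value_cong) (auto simp: nth_append)
  then show "(vs @ [gate_value ((!) vs) g]) ! i =
      gate_value ((!) (vs @ [gate_value ((!) vs) g])) ((gs @ [g]) ! i)"
    using assms(1) i len by (cases "i = length gs") (auto simp: straight_line_def nth_append)
next
  fix i v assume "i < length (gs @ [g])" "(gs @ [g]) ! i = Var_Gate v"
  with assms(1,3) show "v \<in> V"
    by (cases "i = length gs") (auto simp: straight_line_def nth_append less_Suc_eq)
qed (use assms in \<open>simp add: straight_line_def\<close>)

text \<open>The starting program is arbitrary in the induction: the gates for the second operand are
  appended to those for the first, so both results are available to a final gate.\<close>

lemma straight_line_extend:
  assumes "p \<in> polys_in V" "straight_line V gs vs"
  shows "\<exists>gs' vs'. straight_line V (gs @ gs') (vs @ vs') \<and> p \<in> set (vs @ vs')"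
  using assms
proof (induction p arbitrary: gs vs rule: polys_in_induct)
  case (Cst c)
  then show ?case using straight_line_snoc[OF Cst, of "Const_Gate c"] by fastforce
next
  case (Var v)
  then show ?case using straight_line_snoc[OF Var(2), of "Var_Gate v"] by fastforce
next
  case (add p q)
  from add.IH(1)[OF add.prems] obtain gs1 vs1 where 1: "straight_line V (gs @ gs1) (vs @ vs1)" "p \<in> set (vs @ vs1)" by blast
  from add.IH(2)[OF 1(1)] obtain gs2 vs2 where 2: "straight_line V (gs @ gs1 @ gs2) (vs @ vs1 @ vs2)" "q \<in> set (vs @ vs1 @ vs2)" by auto
  let ?gs = "gs @ gs1 @ gs2" and ?vs = "vs @ vs1 @ vs2"
  have "p \<in> set ?vs" using 1 by auto
  then obtain i j where ij: "i < length ?vs" "?vs ! i = p" "j < length ?vs" "?vs ! j = q"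
    using 2(2) by (metis in_set_conv_nth)
  have "length ?vs = length ?gs" using 2(1) by (simp only: straight_line_def)
  then have "straight_line V (?gs @ [Add_Gate 1 i 1 j]) (?vs @ [p + q])"
    using straight_line_snoc[OF 2(1), of "Add_Gate 1 i 1 j"] ij by (auto simp: Cst_def)
  then show ?case
    by (intro exI[of _ "gs1 @ gs2 @ [Add_Gate 1 i 1 j]"] exI[of _ "vs1 @ vs2 @ [p + q]"]) simp
next
  case (mult p q)
  from mult.IH(1)[OF mult.prems] obtain gs1 vs1 where 1: "straight_line V (gs @ gs1) (vs @ vs1)" "p \<in> set (vs @ vs1)" by blast
  from mult.IH(2)[OF 1(1)] obtain gs2 vs2 where 2: "straight_line V (gs @ gs1 @ gs2) (vs @ vs1 @ vs2)" "q \<in> set (vs @ vs1 @ vs2)" by auto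
  let ?gs = "gs @ gs1 @ gs2" and ?vs = "vs @ vs1 @ vs2"
  have "p \<in> set ?vs" using 1 by auto
  then obtain i j where ij: "i < length ?vs" "?vs ! i = p" "j < length ?vs" "?vs ! j = q"
    using 2(2) by (metis in_set_conv_nth)
  have "length ?vs = length ?gs" using 2(1) by (simp only: straight_line_def)
  then have "straight_line V (?gs @ [Mult_Gate 1 i 1 j]) (?vs @ [p * q])"
    using straight_line_snoc[OF 2(1), of "Mult_Gate 1 i 1 j"] ij by (auto simp: Cst_def)
  then show ?case
    by (intro exI[of _ "gs1 @ gs2 @ [Mult_Gate 1 i 1 j]"] exI[of _ "vs1 @ vs2 @ [p * q]"]) simp
qed

lemma exists_circuit:
  fixes p :: "('v, 'k::comm_ring_1) mpoly"
  assumes "p \<in> polys_in V"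
  obtains C :: "('v, 'k) circuit" where "circuit_over V C" "computes C p"
proof -
  have "straight_line V [] ([] :: ('v, 'k) mpoly list)" by (simp add: straight_line_def)
  from straight_line_extend[OF assms this] obtain gs vs
    where s: "straight_line V gs vs" and p: "p \<in> set vs" by auto
  obtain i where i: "i < length gs" "vs ! i = p"
    using s p by (metis in_set_conv_nth straight_line_def)
  let ?C = "\<lparr>gates = {..<length gs}, label = (!) gs, out_gate = i\<rparr>"
  have "edges ?C \<subseteq> {(u, w). u < w}"
    using s by (auto simp: edges_def straight_line_def)
  then have "acyclic (edges ?C)"
    using acyclic_subset wf_acyclic[OF wf_less] by blast
  then have "circuit_over V ?C"
    using s i by (force simp: circuit_over_def straight_line_def)
  moreover have "computes ?C p"
    using s i unfolding computes_def by (intro exI[of _ "(!) vs"]) (simp add: straight_line_def)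
  ultimately show thesis by (rule that)
qed

text \<open>\<open>H a b c\<close> evaluates at a point perturbed in the directions
  \<open>a\<close>, \<open>b\<close>, \<open>c\<close>. First-order coordinates depend on one
  direction each, so products of three of them are the wanted rank-one terms.\<close>

lemma circuit_trilinear_part:
  fixes C :: "('v, 'k::comm_ring_1) circuit"
    and H :: "'i \<Rightarrow> 'i \<Rightarrow> 'i \<Rightarrow> ('v, 'k) mpoly \<Rightarrow> 'l::comm_ring_1 dual3"
  assumes C: "circuit_over V C" "computes C h"
    and H: "\<And>a b c. comm_ring_hom (H a b c)" "\<And>a b c x. H a b c (Cst x) = scalar (\<phi> x)"
    and lin: "\<And>a b c v. v \<in> V \<Longrightarrow> c12 (H a b c (Var v)) = 0 \<and> c13 (H a b c (Var v)) = 0 \<and>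
        c23 (H a b c (Var v)) = 0 \<and> c123 (H a b c (Var v)) = 0"
    and f0: "\<And>a b c x. c0 (H a b c x) = f0 x" and f1: "\<And>a b c x. c1 (H a b c x) = f1 a x"
    and f2: "\<And>a b c x. c2 (H a b c x) = f2 b x" and f3: "\<And>a b c x. c3 (H a b c x) = f3 c x"
  obtains A B G :: "nat \<Rightarrow> 'i \<Rightarrow> 'l"
  where "\<And>a b c. c123 (H a b c h) = (\<Sum>j<6 * mult_complexity C. A j a * B j b * G j c)"
proof -
  obtain val where val: "\<And>w. w \<in> gates C \<Longrightarrow> val w = gate_value val (label C w)" "val (out_gate C) = h"
    using C(2) by (auto simp: computes_def)
  define M where "M = {w \<in> gates C. \<exists>a u b u'. label C w = Mult_Gate a u b u'}"
  have fin: "finite M" using C(1) by (simp add: M_def circuit_over_def)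
  \<comment> \<open>The two scaled inputs of a multiplication gate; both are consulted for gates in
    \<open>M\<close> only, where the \<open>case\<close> is covered.\<close>
  define L where "L g = (case label C g of Mult_Gate a u b u' \<Rightarrow> Cst a * val u)" for g
  define R where "R g = (case label C g of Mult_Gate a u b u' \<Rightarrow> Cst b * val u')" for g
  \<comment> \<open>The part of the product at \<open>g\<close> that pairs first-order parts of both
    factors.\<close>
  define q12 where "q12 a b g = f1 a (L g) * f2 b (R g) + f2 b (L g) * f1 a (R g)" for a b g
  define q13 where "q13 a c g = f1 a (L g) * f3 c (R g) + f3 c (L g) * f1 a (R g)" for a c g
  define q23 where "q23 b c g = f2 b (L g) * f3 c (R g) + f3 c (L g) * f2 b (R g)" for b c g
  \<comment> \<open>The cubic analogue: a first-order part of one factor meets a second-order part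
    of the other.\<close>
  define K where "K a b c g =
      f1 a (L g) * c23 (H a b c (R g)) + c23 (H a b c (L g)) * f1 a (R g) +
      f2 b (L g) * c13 (H a b c (R g)) + c13 (H a b c (L g)) * f2 b (R g) +
      f3 c (L g) * c12 (H a b c (R g)) + c12 (H a b c (L g)) * f3 c (R g)" for a b c g
  \<comment> \<open>The coefficients \<open>d\<close> and \<open>e\<close> are chosen before the
    directions, which lets the sums factor later; one \<open>d\<close> serves all three quadratic
    coordinates.\<close>
  define good where "good x \<longleftrightarrow> (\<exists>d e. \<forall>a b c.
      c12 (H a b c x) = (\<Sum>g\<in>M. d g * q12 a b g) \<and>
      c13 (H a b c x) = (\<Sum>g\<in>M. d g * q13 a c g) \<and>
      c23 (H a b c x) = (\<Sum>g\<in>M. d g * q23 b c g) \<and>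
      c123 (H a b c x) = (\<Sum>g\<in>M. e g * K a b c g))" for x
  have H_add: "H a b c (x + y) = H a b c x + H a b c y"
    and H_mult: "H a b c (x * y) = H a b c x * H a b c y" for a b c x y
  proof -
    interpret comm_ring_hom "H a b c" by (rule H(1))
    show "H a b c (x + y) = H a b c x + H a b c y" "H a b c (x * y) = H a b c x * H a b c y"
      by (rule hom_add, rule hom_mult)
  qed
  have good_add: "good (x + y)" if "good x" "good y" for x y
  proof -
    from that(1) obtain d e where 1: "\<forall>a b c.
      c12 (H a b c x) = (\<Sum>g\<in>M. d g * q12 a b g) \<and> c13 (H a b c x) = (\<Sum>g\<in>M. d g * q13 a c g) \<and>
      c23 (H a b c x) = (\<Sum>g\<in>M. d g * q23 b c g) \<and> c123 (H a b c x) = (\<Sum>g\<in>M. e g * K a b c g)"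
      unfolding good_def by blast
    from that(2) obtain d' e' where 2: "\<forall>a b c.
      c12 (H a b c y) = (\<Sum>g\<in>M. d' g * q12 a b g) \<and> c13 (H a b c y) = (\<Sum>g\<in>M. d' g * q13 a c g) \<and>
      c23 (H a b c y) = (\<Sum>g\<in>M. d' g * q23 b c g) \<and> c123 (H a b c y) = (\<Sum>g\<in>M. e' g * K a b c g)"
      unfolding good_def by blast
    show ?thesis unfolding good_def
      by (rule exI[of _ "\<lambda>g. d g + d' g"], rule exI[of _ "\<lambda>g. e g + e' g"])
         (simp add: H_add 1 2 sum.distrib ring_distribs)
  qed
  have good_scale: "good (Cst s * x)" if "good x" for s x
  proof -
    from that(1) obtain d e where 1: "\<forall>a b c.
      c12 (H a b c x) = (\<Sum>g\<in>M. d g * q12 a b g) \<and> c13 (H a b c x) = (\<Sum>g\<in>M. d g * q13 a c g) \<and>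
      c23 (H a b c x) = (\<Sum>g\<in>M. d g * q23 b c g) \<and> c123 (H a b c x) = (\<Sum>g\<in>M. e g * K a b c g)"
      unfolding good_def by blast
    show ?thesis unfolding good_def
      by (rule exI[of _ "\<lambda>g. \<phi> s * d g"], rule exI[of _ "\<lambda>g. \<phi> s * e g"])
         (simp add: H_mult H(2) coord_mult 1 sum_distrib_left mult.assoc)
  qed
  have good_lin: "good x" if "\<And>a b c. c12 (H a b c x) = 0 \<and> c13 (H a b c x) = 0 \<and>
        c23 (H a b c x) = 0 \<and> c123 (H a b c x) = 0" for x
    unfolding good_def by (rule exI[of _ "\<lambda>_. 0"], rule exI[of _ "\<lambda>_. 0"]) (simp add: that)
  have good_mult: "good (L w * R w)" if "w \<in> M" "good (L w)" "good (R w)" for w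
  proof -
    from that(2) obtain d e where 1: "\<forall>a b c.
      c12 (H a b c (L w)) = (\<Sum>g\<in>M. d g * q12 a b g) \<and> c13 (H a b c (L w)) = (\<Sum>g\<in>M. d g * q13 a c g) \<and>
      c23 (H a b c (L w)) = (\<Sum>g\<in>M. d g * q23 b c g) \<and> c123 (H a b c (L w)) = (\<Sum>g\<in>M. e g * K a b c g)"
      unfolding good_def by blast
    from that(3) obtain d' e' where 2: "\<forall>a b c.
      c12 (H a b c (R w)) = (\<Sum>g\<in>M. d' g * q12 a b g) \<and> c13 (H a b c (R w)) = (\<Sum>g\<in>M. d' g * q13 a c g) \<and>
      c23 (H a b c (R w)) = (\<Sum>g\<in>M. d' g * q23 b c g) \<and> c123 (H a b c (R w)) = (\<Sum>g\<in>M. e' g * K a b c g)"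
      unfolding good_def by blast
    have delta: "(\<Sum>g\<in>M. (if g = w then 1 else 0) * F g) = F w" for F :: "nat \<Rightarrow> 'l"
      using fin that(1) by (simp add: if_distrib[of "\<lambda>x. x * _"] cong: if_cong)
    \<comment> \<open>By the product rule the combinations of the factors are scaled by the constant
      terms \<open>f0\<close>, and gate \<open>w\<close> itself enters with coefficient 1.\<close>
    have comb: "(\<Sum>g\<in>M. (f0 (L w) * t' g + t g * f0 (R w) + (if g = w then 1 else 0)) * F g) =
        f0 (L w) * (\<Sum>g\<in>M. t' g * F g) + (\<Sum>g\<in>M. t g * F g) * f0 (R w) + F w" for t t' F :: "nat \<Rightarrow> 'l"
      by (simp only: distrib_right sum.distrib delta) (simp add: sum_distrib_left sum_distrib_right mult_ac)
    have K: "c123 (H a b c (L w * R w)) = f0 (L w) * c123 (H a b c (R w)) + c123 (H a b c (L w)) * f0 (R w) + K a b c w" for a b c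
      by (simp add: H_mult coord_mult f0 f1 f2 f3 K_def)
    show ?thesis unfolding good_def
      by (rule exI[of _ "\<lambda>g. f0 (L w) * d' g + d g * f0 (R w) + (if g = w then 1 else 0)"],
          rule exI[of _ "\<lambda>g. f0 (L w) * e' g + e g * f0 (R w) + (if g = w then 1 else 0)"],
          unfold comb K)
         (simp add: H_mult coord_mult(5-7) 1 2 f0 f1 f2 f3 q12_def q13_def q23_def)
  qed
  have edges: "edges C \<subseteq> gates C \<times> gates C" using C(1) by (auto simp: edges_def circuit_over_def)
  then have "finite (edges C)" using C(1) by (auto simp: circuit_over_def intro: finite_subset)
  then have wf: "wf (edges C)" using C(1) by (simp add: circuit_over_def finite_acyclic_wf)
  have good_val: "w \<in> gates C \<longrightarrow> good (val w)" for w
    using wf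
  proof (induction w rule: wf_induct_rule)
    case (less w)
    show ?case
    proof
      assume w: "w \<in> gates C"
      have IH: "good (val u)" if "u \<in> preds (label C w)" for u
        using less.IH[of u] that w C(1) by (auto simp: edges_def circuit_over_def)
      show "good (val w)"
      proof (cases "label C w")
        case (Const_Gate c)
        then have v: "val w = Cst c" using val(1)[OF w] by simp
        show ?thesis by (rule good_lin) (simp add: v H)
      next
        case (Var_Gate v)
        then have v: "val w = Var v" "v \<in> V" using val(1)[OF w] C(1) w by (auto simp: circuit_over_def)
        show ?thesis by (rule good_lin) (simp add: v lin)
      next
        case (Add_Gate a u b u')
        then show ?thesis using val(1)[OF w] IH by (auto intro!: good_add good_scale)
      next
        case (Mult_Gate a u b u')
        then have "good (L w)" "good (R w)" "w \<in> M" "val w = L w * R w"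
          using val(1)[OF w] IH w by (auto intro!: good_scale simp: L_def R_def M_def)
        then show ?thesis using good_mult by simp
      qed
    qed
  qed
  have good_LR: "good (L g)" "good (R g)" if "g \<in> M" for g
  proof -
    from that obtain a u b u' where g: "g \<in> gates C" "label C g = Mult_Gate a u b u'"
      by (auto simp: M_def)
    then have "u \<in> gates C" "u' \<in> gates C" using C(1) by (fastforce simp: circuit_over_def)+
    then show "good (L g)" "good (R g)"
      using good_val g(2) by (auto simp: L_def R_def intro!: good_scale)
  qed
  define quad where "quad x d \<longleftrightarrow> (\<forall>a b c. c12 (H a b c x) = (\<Sum>h\<in>M. d h * q12 a b h) \<and>
      c13 (H a b c x) = (\<Sum>h\<in>M. d h * q13 a c h) \<and> c23 (H a b c x) = (\<Sum>h\<in>M. d h * q23 b c h))"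
    for x d
  have quad: "\<exists>d. quad x d" if "good x" for x
    using that unfolding good_def quad_def by blast
  have "\<forall>g\<in>M. \<exists>d. quad (L g) d" "\<forall>g\<in>M. \<exists>d. quad (R g) d"
    using good_LR by (auto intro: quad)
  then obtain dL dR where d: "\<forall>g\<in>M. quad (L g) (dL g)" "\<forall>g\<in>M. quad (R g) (dR g)"
    using bchoice[of M "\<lambda>g. quad (L g)"] bchoice[of M "\<lambda>g. quad (R g)"] by blast
  have
    dL: "c12 (H a b c (L g)) = (\<Sum>h\<in>M. dL g h * q12 a b h)"
      "c13 (H a b c (L g)) = (\<Sum>h\<in>M. dL g h * q13 a c h)"
      "c23 (H a b c (L g)) = (\<Sum>h\<in>M. dL g h * q23 b c h)" and
    dR: "c12 (H a b c (R g)) = (\<Sum>h\<in>M. dR g h * q12 a b h)"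
      "c13 (H a b c (R g)) = (\<Sum>h\<in>M. dR g h * q13 a c h)"
      "c23 (H a b c (R g)) = (\<Sum>h\<in>M. dR g h * q23 b c h)" if "g \<in> M" for a b c g
    using d that by (simp_all add: quad_def)
  have "good h" using good_val[of "out_gate C"] C(1) val(2) by (simp add: circuit_over_def)
  then obtain e where e: "\<And>a b c. c123 (H a b c h) = (\<Sum>g\<in>M. e g * K a b c g)"
    unfolding good_def by blast
  \<comment> \<open>After the sums over \<open>g\<close> and \<open>h\<close> are exchanged,
    everything that multiplies one quadratic form of gate \<open>h\<close> is a single linear form.
    This keeps the count linear, not quadratic, in the number of gates.\<close>
  define W1 where "W1 a h = (\<Sum>g\<in>M. e g * (dR g h * f1 a (L g) + dL g h * f1 a (R g)))" for a h
  define W2 where "W2 b h = (\<Sum>g\<in>M. e g * (dR g h * f2 b (L g) + dL g h * f2 b (R g)))" for b h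
  define W3 where "W3 c h = (\<Sum>g\<in>M. e g * (dR g h * f3 c (L g) + dL g h * f3 c (R g)))" for c h
  have T: "c123 (H a b c h) = (\<Sum>h\<in>M. W1 a h * q23 b c h + W2 b h * q13 a c h + W3 c h * q12 a b h)" for a b c
  proof -
    let ?F = "\<lambda>g h. e g * (dR g h * f1 a (L g) + dL g h * f1 a (R g)) * q23 b c h +
        e g * (dR g h * f2 b (L g) + dL g h * f2 b (R g)) * q13 a c h +
        e g * (dR g h * f3 c (L g) + dL g h * f3 c (R g)) * q12 a b h"
    have S: "(\<Sum>h\<in>M. e g * (dR g h * x + dL g h * y) * q h) =
        e g * (x * (\<Sum>h\<in>M. dR g h * q h) + (\<Sum>h\<in>M. dL g h * q h) * y)" for g x y q
      unfolding distrib_left distrib_right sum.distrib sum_distrib_left sum_distrib_right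
      by (simp only: mult_ac)
    have "c123 (H a b c h) = (\<Sum>g\<in>M. \<Sum>h\<in>M. ?F g h)"
      unfolding e
    proof (rule sum.cong[OF refl])
      fix g assume g: "g \<in> M"
      show "e g * K a b c g = (\<Sum>h\<in>M. ?F g h)"
        unfolding K_def sum.distrib S by (simp add: dL[OF g] dR[OF g] distrib_left add.assoc)
    qed
    also have "\<dots> = (\<Sum>h\<in>M. \<Sum>g\<in>M. ?F g h)"
      by (rule sum.swap)
    finally show ?thesis
      unfolding W1_def W2_def W3_def sum_distrib_right sum.distrib .
  qed
  \<comment> \<open>Each of the three quadratic forms of gate \<open>h\<close> has two summands, so
    six products arise, listed by position.\<close>
  define A where "A = (\<lambda>(h, i) a. [W1 a h, W1 a h, f1 a (L h), f1 a (R h), f1 a (L h), f1 a (R h)] ! i)"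
  define B where "B = (\<lambda>(h, i) b. [f2 b (L h), f2 b (R h), W2 b h, W2 b h, f2 b (R h), f2 b (L h)] ! i)"
  define G where "G = (\<lambda>(h, i) c. [f3 c (R h), f3 c (L h), f3 c (R h), f3 c (L h), W3 c h, W3 c h] ! i)"
  have T': "c123 (H a b c h) = (\<Sum>x\<in>M \<times> {..<6::nat}. A x a * B x b * G x c)" for a b c
  proof -
    have "W1 a h * q23 b c h + W2 b h * q13 a c h + W3 c h * q12 a b h =
        (\<Sum>i<6::nat. A (h, i) a * B (h, i) b * G (h, i) c)" for h
      by (simp add: A_def B_def G_def numeral_eq_Suc q12_def q13_def q23_def algebra_simps)
    then show ?thesis unfolding T by (simp add: sum.cartesian_product)
  qed
  have "card (M \<times> {..<6::nat}) = 6 * mult_complexity C"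
    by (simp add: mult_complexity_def M_def card_cartesian_product)
  moreover have "finite (M \<times> {..<6::nat})" using fin by simp
  ultimately obtain \<sigma> where \<sigma>: "bij_betw \<sigma> {..<6 * mult_complexity C} (M \<times> {..<6::nat})"
    by (metis ex_bij_betw_nat_finite atLeast0LessThan)
  show thesis
  proof (rule that[of "\<lambda>j. A (\<sigma> j)" "\<lambda>j. B (\<sigma> j)" "\<lambda>j. G (\<sigma> j)"])
    fix a b c
    show "c123 (H a b c h) = (\<Sum>j<6 * mult_complexity C. A (\<sigma> j) a * B (\<sigma> j) b * G (\<sigma> j) c)"
      unfolding T' by (rule sum.reindex_bij_betw[OF \<sigma>, symmetric])
  qed
qed

section \<open>Degeneration of polynomials in a determinantal ideal\<close>

lemma eval_mpoly_cong:
  assumes "p \<in> polys_in V" "\<And>v. v \<in> V \<Longrightarrow> x v = y v"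
  shows "eval_mpoly h x p = eval_mpoly h y p"
proof -
  have "eval_monom x t = eval_monom y t" if "t \<in> Poly_Mapping.keys p" for t
    unfolding eval_monom_def by (rule prod.cong) (use assms that in \<open>auto simp: polys_in_def subset_iff\<close>)
  then show ?thesis by (simp add: eval_mpoly_def)
qed

lemma eval_mpoly_dvd_diff:
  fixes p :: "('v, 'k::comm_ring_1) mpoly"
  assumes h: "comm_ring_hom h" and d: "\<And>v. d dvd x v - y v"
  shows "d dvd eval_mpoly h x p - eval_mpoly h y p"
proof -
  have "p \<in> polys_in UNIV" by (simp add: polys_in_def)
  then show ?thesis
  proof (induction p rule: polys_in_induct)
    case (add p q)
    have "eval_mpoly h x (p + q) - eval_mpoly h y (p + q) =
        (eval_mpoly h x p - eval_mpoly h y p) + (eval_mpoly h x q - eval_mpoly h y q)"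
      by (simp add: eval_mpoly_add[OF h])
    then show ?case using add by simp
  next
    case (mult p q)
    have "eval_mpoly h x (p * q) - eval_mpoly h y (p * q) =
        (eval_mpoly h x p - eval_mpoly h y p) * eval_mpoly h x q +
        eval_mpoly h y p * (eval_mpoly h x q - eval_mpoly h y q)"
      by (simp add: eval_mpoly_mult[OF h] algebra_simps)
    then show ?case using mult by simp
  qed (simp_all add: h d)
qed

text \<open>\<open>\<Psi>\<close> is \<open>f (L D U)\<close> with \<open>L\<close> and \<open>U\<close> generic square respectively rectangular matrices, viewed as a
  polynomial in the entries of the diagonal matrix \<open>D\<close>.\<close>

lemma generic_diagonal_product:
  fixes f :: "(nat \<times> nat, 'a::field_char_0) mpoly"
  assumes f: "f \<in> det_ideal n m r" "f \<noteq> 0"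
  obtains \<Psi> :: "(nat, ((nat \<times> nat) + (nat \<times> nat), 'a) mpoly) mpoly"
  where "\<Psi> \<noteq> 0"
    and "\<And>t. t \<in> Poly_Mapping.keys \<Psi> \<Longrightarrow> Poly_Mapping.keys t \<subseteq> {..<n} \<and> r \<le> card (Poly_Mapping.keys t)"
    and "\<And>(h :: 'a \<Rightarrow> 'b::comm_ring_1) l d u. comm_ring_hom h \<Longrightarrow>
      eval_mpoly (eval_mpoly h (case_sum l u)) d \<Psi> =
      eval_mpoly h (\<lambda>(i, j). \<Sum>t<n. l (i, t) * d t * u (t, j)) f"
proof -
  \<comment> \<open>\<open>Inl\<close> marks entries of L and \<open>Inr\<close> entries of U. Both
    live in the coefficients, so only the entries of D count as variables.\<close>
  define X where "X = (\<lambda>(i, j). \<Sum>t<n. Cst (Var (Inl (i, t)) * Var (Inr (t, j))) * Var t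
    :: (nat, ((nat \<times> nat) + (nat \<times> nat), 'a) mpoly) mpoly)"
  define \<Psi> where "\<Psi> = eval_mpoly (\<lambda>c. Cst (Cst c)) X f"
  have CC: "comm_ring_hom (\<lambda>c. Cst (Cst c))"
    by (rule comm_ring_hom_compose[OF comm_ring_hom_Cst comm_ring_hom_Cst])
  have ev: "eval_mpoly (eval_mpoly h (case_sum l u)) d \<Psi> =
      eval_mpoly h (\<lambda>(i, j). \<Sum>t<n. l (i, t) * d t * u (t, j)) f"
    if h: "comm_ring_hom h" for h :: "'a \<Rightarrow> 'c::comm_ring_1" and l d u
  proof -
    have g: "comm_ring_hom (eval_mpoly h (case_sum l u))"
      by (rule comm_ring_hom_eval_mpoly[OF h])
    have "eval_mpoly (eval_mpoly h (case_sum l u)) d (X (i, j)) = (\<Sum>t<n. l (i, t) * d t * u (t, j))" for i j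
      unfolding X_def prod.case eval_mpoly_sum[OF g] eval_mpoly_mult[OF g] eval_mpoly_Cst[OF g]
        eval_mpoly_Var[OF g] eval_mpoly_mult[OF h] eval_mpoly_Var[OF h] sum.case
      by (simp only: mult_ac)
    then have "(\<lambda>v. eval_mpoly (eval_mpoly h (case_sum l u)) d (X v)) = (\<lambda>(i, j). \<Sum>t<n. l (i, t) * d t * u (t, j))"
      by (simp add: fun_eq_iff)
    then show ?thesis
      unfolding \<Psi>_def eval_mpoly_eval_mpoly[OF g] eval_mpoly_Cst[OF g] eval_mpoly_Cst[OF h] by simp
  qed
  have "\<Psi> \<noteq> 0"
  proof
    assume 0: "\<Psi> = 0"
    have id: "comm_ring_hom (\<lambda>c. c :: 'a)" by standard auto
    obtain M where M: "eval_mpoly (\<lambda>c. c) M f \<noteq> 0"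
      using exists_eval_mpoly_nonzero[OF f(2)] by blast
    \<comment> \<open>With L and D the identity and U = \<open>M\<close>, the product agrees with
      \<open>M\<close> at all variables that \<open>f\<close> can contain.\<close>
    have "eval_mpoly (\<lambda>c. c) M f =
        eval_mpoly (\<lambda>c. c) (\<lambda>(i, j). \<Sum>t<n. (if i = t then 1 else 0) * 1 * M (t, j)) f"
      by (rule eval_mpoly_cong[of _ "matrix_vars n m"])
         (use f(1) det_ideal_subset_polys_in[of n m r]
          in \<open>auto simp: matrix_vars_def if_distrib[of "\<lambda>x. x * _"] cong: if_cong\<close>)
    also have "\<dots> = 0"
      using ev[OF id, of "\<lambda>(i, t). if i = t then 1 else 0" M "\<lambda>_. 1"]
      by (simp add: 0 comm_ring_hom_eval_mpoly[OF id])
    finally show False using M by contradiction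
  qed
  \<comment> \<open>With the entries of D outside \<open>S\<close> set to zero, the product factors
    through \<open>S\<close>.\<close>
  moreover have restrict: "eval_mpoly Cst (\<lambda>v. if v \<in> S then Var v else 0) \<Psi> =
      eval_mpoly (\<lambda>c. Cst (Cst c)) (\<lambda>(i, j). \<Sum>t\<in>S. Cst (Var (Inl (i, t))) * (Cst (Var (Inr (t, j))) * Var t)) f"
    if S: "S \<subseteq> {..<n}" for S
  proof -
    have C: "Cst (p * q) = Cst p * Cst q" for p q :: "((nat \<times> nat) + (nat \<times> nat), 'a) mpoly"
      by (simp add: Cst_def mult_single)
    have "(\<Sum>t<n. Cst (Var (Inl (i, t)) * Var (Inr (t, j))) * (if t \<in> S then Var t else 0)) =
        (\<Sum>t\<in>S. Cst (Var (Inl (i, t))) * (Cst (Var (Inr (t, j))) *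
          (Var t :: (nat, ((nat \<times> nat) + (nat \<times> nat), 'a) mpoly) mpoly)))" for i j
      by (rule sum.mono_neutral_cong_right) (use S in \<open>auto simp: C mult.assoc\<close>)
    then show ?thesis
      unfolding \<Psi>_def eval_mpoly_eval_mpoly[OF comm_ring_hom_Cst]
      by (intro arg_cong3[of _ _ _ _ _ _ eval_mpoly])
         (auto simp: X_def fun_eq_iff eval_mpoly_sum eval_mpoly_mult comm_ring_hom_Cst)
  qed
  have "Poly_Mapping.keys t \<subseteq> {..<n} \<and> r \<le> card (Poly_Mapping.keys t)" if t: "t \<in> Poly_Mapping.keys \<Psi>" for t
  proof
    have "eval_mpoly Cst (\<lambda>v. if v \<in> {..<n} then Var v else 0) \<Psi> = \<Psi>"
      unfolding restrict[OF order_refl] unfolding \<Psi>_def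
      by (intro arg_cong3[of _ _ _ _ _ _ eval_mpoly])
         (auto simp: X_def fun_eq_iff Cst_def mult_single simp flip: mult.assoc)
    then show n: "Poly_Mapping.keys t \<subseteq> {..<n}"
      using t lookup_eval_mpoly_restrict[of "{..<n}" \<Psi> t] by (auto simp: in_keys_iff split: if_splits)
    show "r \<le> card (Poly_Mapping.keys t)"
    proof (rule ccontr)
      assume "\<not> r \<le> card (Poly_Mapping.keys t)"
      \<comment> \<open>If the support of \<open>t\<close> were this small, restriction to it would
        kill \<open>\<Psi>\<close>, although the term at \<open>t\<close> itself survives the
        restriction.\<close>
      then have "eval_mpoly Cst (\<lambda>v. if v \<in> Poly_Mapping.keys t then Var v else 0) \<Psi> = 0"
        unfolding restrict[OF n] by (intro det_ideal_eval_eq_0[OF f(1) CC]) auto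
      then show False
        using t lookup_eval_mpoly_restrict[of "Poly_Mapping.keys t" \<Psi> t] by (simp add: in_keys_iff)
    qed
  qed
  ultimately show thesis using ev by (intro that)
qed

text \<open>All other monomials carry a higher power of \<open>\<delta>\<close>, and congruent
  arguments give congruent leading coefficients. Since \<open>e\<close> squares to zero, (1 + e)^N =
  1 + N e, which exposes the exponent of \<open>p\<close> in \<open>\<alpha>\<close>.\<close>

lemma leading_term:
  fixes \<Psi> :: "(nat, ('u, 'a::comm_ring_1) mpoly) mpoly" and h :: "'a \<Rightarrow> 'b::comm_ring_1"
  assumes h: "comm_ring_hom h"
    and \<alpha>: "\<alpha> \<in> Poly_Mapping.keys \<Psi>"
      "\<And>\<beta>. \<beta> \<in> Poly_Mapping.keys \<Psi> \<Longrightarrow> \<beta> \<noteq> \<alpha> \<Longrightarrow> weight w \<alpha> < weight w \<beta>"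
    and y: "\<And>v. \<delta> dvd y v - h (x v)" and e: "e * e = 0"
  shows "\<delta> ^ Suc (weight w \<alpha>) dvd
    eval_mpoly (eval_mpoly h y) (\<lambda>t. \<delta> ^ w t * (1 + (if t = p then e else 0))) \<Psi> -
    \<delta> ^ weight w \<alpha> * h (eval_mpoly (\<lambda>c. c) x (Poly_Mapping.lookup \<Psi> \<alpha>)) * (1 + of_nat (Poly_Mapping.lookup \<alpha> p) * e)"
proof -
  interpret h: comm_ring_hom h by (rule h)
  have pw: "(1 + e) ^ N = 1 + of_nat N * e" for N
  proof (induction N)
    case (Suc N)
    have "(1 + e) ^ Suc N = 1 + of_nat (Suc N) * e + of_nat N * (e * e)"
      by (simp add: Suc.IH algebra_simps)
    then show ?case by (simp only: e mult_zero_right add_0_right)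
  qed simp
  have mon: "eval_monom (\<lambda>t. \<delta> ^ w t * (1 + (if t = p then e else 0))) \<beta> =
      \<delta> ^ weight w \<beta> * (1 + of_nat (Poly_Mapping.lookup \<beta> p) * e)" for \<beta>
  proof -
    have "(\<Prod>t\<in>Poly_Mapping.keys \<beta>. (1 + (if t = p then e else 0)) ^ Poly_Mapping.lookup \<beta> t) =
        (\<Prod>t\<in>Poly_Mapping.keys \<beta>. if t = p then (1 + e) ^ Poly_Mapping.lookup \<beta> p else 1)"
      by (rule prod.cong) auto
    also have "\<dots> = (1 + e) ^ Poly_Mapping.lookup \<beta> p"
      by (simp add: prod.delta in_keys_iff)
    finally show ?thesis
      unfolding pw eval_monom_power[symmetric]
      by (simp add: eval_monom_def power_mult_distrib prod.distrib)
  qed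
  let ?F = "\<lambda>\<beta>. eval_mpoly h y (Poly_Mapping.lookup \<Psi> \<beta>) *
    (\<delta> ^ weight w \<beta> * (1 + of_nat (Poly_Mapping.lookup \<beta> p) * e))"
  have "eval_mpoly (eval_mpoly h y) (\<lambda>t. \<delta> ^ w t * (1 + (if t = p then e else 0))) \<Psi> =
      ?F \<alpha> + (\<Sum>\<beta>\<in>Poly_Mapping.keys \<Psi> - {\<alpha>}. ?F \<beta>)"
    unfolding eval_mpoly_def[of "eval_mpoly h y"] mon by (rule sum.remove) (use \<alpha> in auto)
  moreover have "\<delta> ^ Suc (weight w \<alpha>) dvd (\<Sum>\<beta>\<in>Poly_Mapping.keys \<Psi> - {\<alpha>}. ?F \<beta>)"
    by (intro dvd_sum dvd_mult dvd_mult2 le_imp_power_dvd) (use \<alpha>(2) in \<open>auto simp: Suc_le_eq\<close>)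
  moreover have "\<delta> ^ Suc (weight w \<alpha>) dvd ?F \<alpha> - \<delta> ^ weight w \<alpha> *
      h (eval_mpoly (\<lambda>c. c) x (Poly_Mapping.lookup \<Psi> \<alpha>)) * (1 + of_nat (Poly_Mapping.lookup \<alpha> p) * e)"
  proof -
    have "\<delta> dvd eval_mpoly h y (Poly_Mapping.lookup \<Psi> \<alpha>) - eval_mpoly h (\<lambda>v. h (x v)) (Poly_Mapping.lookup \<Psi> \<alpha>)"
      by (rule eval_mpoly_dvd_diff[OF h y])
    then have "\<delta> * \<delta> ^ weight w \<alpha> dvd (eval_mpoly h y (Poly_Mapping.lookup \<Psi> \<alpha>) -
        h (eval_mpoly (\<lambda>c. c) x (Poly_Mapping.lookup \<Psi> \<alpha>))) *
        (\<delta> ^ weight w \<alpha> * (1 + of_nat (Poly_Mapping.lookup \<alpha> p) * e))"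
      unfolding hom_eval_mpoly[OF h] by (intro mult_dvd_mono dvd_triv_left)
    then show ?thesis by (simp add: algebra_simps)
  qed
  ultimately show ?thesis by (simp only: add_diff_eq[symmetric] add.commute[of "?F \<alpha>"] dvd_add)
qed

text \<open>An \<open>LDU\<close> decomposition of a perturbed identity matrix, conjugated by \<open>diag (\<delta>^(a 0), \<delta>^(a 1), \<dots>)\<close>:
  since \<open>a\<close> is increasing, the conjugated unitriangular factors are the identity modulo \<open>\<delta>\<close>.\<close>

lemma perturbed_identity_LDU:
  fixes \<delta> e1 e2 e3 :: "'b::comm_ring_1" and a :: "nat \<Rightarrow> nat"
  assumes a: "strict_mono a" and e: "e1 * e1 = 0" "e2 * e2 = 0" "e3 * e3 = 0"
    and ord: "p1 < q1" "p1 < p2" "q3 < q1" "q3 < p2" "q1 < q2" "q1 < p3" "p2 < q2" "p2 < p3"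
    and bound: "p3 < n" "q2 < n"
  obtains L U :: "nat \<Rightarrow> nat \<Rightarrow> 'b"
  where "\<And>u v. \<delta> dvd L u v - (if u = v then 1 else 0)"
    and "\<And>u v. \<delta> dvd U u v - (if u = v then 1 else 0)"
    and "\<And>u v. u < n \<Longrightarrow> v < n \<Longrightarrow>
      (\<Sum>t<n. L u t * (\<delta> ^ (2 * a t) * (1 + (if t = p3 then if q3 = p1 \<and> q1 = p2 \<and> q2 = p3 then e1 * e2 * e3 else 0 else 0))) * U t v) =
      \<delta> ^ a u * ((if u = v then 1 else 0) + (if u = p1 \<and> v = q1 then e1 else 0) +
        (if u = p2 \<and> v = q2 then e2 else 0) + (if u = p3 \<and> v = q3 then e3 else 0)) * \<delta> ^ a v"
proof -
  define d where "d t = \<delta> ^ a t" for t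
  \<comment> \<open>For \<open>s < t\<close> this is the quotient of \<open>d t\<close> by
    \<open>d s\<close> without division: the factor that conjugation puts on an off-diagonal
    entry.\<close>
  define c where "c s t = \<delta> ^ (a t - a s)" for s t
  have cd: "c s t * d s = d t" if "s < t" for s t
    using strict_monoD[OF a that] by (simp add: c_def d_def flip: power_add)
  have dc: "\<delta> dvd c s t" if "s < t" for s t
    using strict_monoD[OF a that] by (simp add: c_def dvd_power)
  define \<chi> where "\<chi> \<longleftrightarrow> q3 = p1 \<and> q1 = p2"
  \<comment> \<open>Gaussian elimination in row \<open>p3\<close>. Subtracting a multiple of row
    \<open>q3\<close> leaves -e3 e1 in column \<open>q1\<close> if \<open>q3 = p1\<close>; clearing
    that with row \<open>q1\<close> leaves e1 e2 e3 in column \<open>q2\<close> if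
    \<open>\<chi>\<close> holds. This last entry goes to L, D or U according as \<open>q2\<close>
    lies before, at or after \<open>p3\<close>.\<close>
  define A1 where "A1 u = (if u = p3 then c q3 p3 * e3 else 0)" for u
  define A2 where "A2 u = (if u = p3 \<and> q3 = p1 then - c q1 p3 * (e3 * e1) else 0)" for u
  define A3 where "A3 u = (if u = p3 \<and> \<chi> \<and> q2 < p3 then c q2 p3 * (e1 * e2 * e3) else 0)" for u
  define B where "B t v = (if t = p1 \<and> v = q1 then c p1 q1 * e1 else 0) +
    (if t = p2 \<and> v = q2 then c p2 q2 * e2 else 0) +
    (if t = p3 \<and> v = q2 \<and> \<chi> \<and> p3 < q2 then c p3 q2 * (e1 * e2 * e3) else 0)" for t v
  define A where "A u t = (if t = q3 then A1 u else 0) + (if t = q1 then A2 u else 0) + (if t = q2 then A3 u else 0)" for u t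
  define D where "D t = d t * d t * (1 + (if t = p3 then if \<chi> \<and> q2 = p3 then e1 * e2 * e3 else 0 else 0))" for t
  define L where "L u t = (if u = t then 1 else 0) + A u t" for u t
  define U where "U t v = (if t = v then 1 else 0) + B t v" for t v
  have sq: "e1 * (e1 * z) = 0" "e2 * (e2 * z) = 0" "e3 * (e3 * z) = 0" for z
    using e by (simp_all flip: mult.assoc)
  have lt: "q1 < n" "q3 < n" using ord bound by auto
  have "(\<Sum>t<n. L u t * D t * U t v) =
      d u * ((if u = v then 1 else 0) + (if u = p1 \<and> v = q1 then e1 else 0) +
        (if u = p2 \<and> v = q2 then e2 else 0) + (if u = p3 \<and> v = q3 then e3 else 0)) * d v"
    if uv: "u < n" "v < n" for u v
  proof -
    have "(\<Sum>t<n. L u t * D t * U t v) =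
        (\<Sum>t<n. if t = u then D u * U u v else 0) + (\<Sum>t<n. A u t * (D t * U t v))"
      by (subst sum.distrib[symmetric], rule sum.cong) (auto simp: L_def algebra_simps)
    also have "(\<Sum>t<n. A u t * (D t * U t v)) =
        (\<Sum>t<n. if t = q3 then A1 u * (D q3 * U q3 v) else 0) +
        (\<Sum>t<n. if t = q1 then A2 u * (D q1 * U q1 v) else 0) +
        (\<Sum>t<n. if t = q2 then A3 u * (D q2 * U q2 v) else 0)"
      by (subst sum.distrib[symmetric], subst sum.distrib[symmetric], rule sum.cong)
         (auto simp: A_def algebra_simps)
    finally have sum: "(\<Sum>t<n. L u t * D t * U t v) = D u * U u v + A1 u * (D q3 * U q3 v) +
        A2 u * (D q1 * U q1 v) + A3 u * (D q2 * U q2 v)"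
      using uv lt bound by simp
    show ?thesis
    \<comment> \<open>In every other row L is the identity, so only D and U matter there.\<close>
    proof (cases "u = p3")
      case False
      have "D u * B u v = d u * ((if u = p1 \<and> v = q1 then e1 else 0) + (if u = p2 \<and> v = q2 then e2 else 0)) * d v"
        using False ord cd[of p1 q1] cd[of p2 q2] by (auto simp: D_def B_def algebra_simps)
      then show ?thesis
        unfolding sum using False by (auto simp: A1_def A2_def A3_def D_def U_def algebra_simps)
    next
      case True
      have q3: "A1 u * (D q3 * U q3 v) = d p3 * (if v = q3 then e3 else 0) * d v +
          d p3 * (if q3 = p1 \<and> v = q1 then e3 * e1 else 0) * d v"
        using ord True cd[of q3 p3, symmetric] cd[of p1 q1, symmetric]
        by (auto simp: A1_def D_def U_def B_def algebra_simps)
      have q1: "A2 u * (D q1 * U q1 v) = - d p3 * (if q3 = p1 \<and> v = q1 then e3 * e1 else 0) * d v -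
          d p3 * (if \<chi> \<and> v = q2 then e1 * e2 * e3 else 0) * d v"
        using ord True cd[of q1 p3, symmetric] cd[of p2 q2, symmetric]
        by (auto simp: A2_def D_def U_def B_def \<chi>_def algebra_simps)
      have q2: "A3 u * (D q2 * U q2 v) = d p3 * (if \<chi> \<and> q2 < p3 \<and> v = q2 then e1 * e2 * e3 else 0) * d v"
        using ord True cd[of q2 p3]
        by (auto simp: A3_def D_def U_def B_def algebra_simps)
      have p3: "D u * U u v = d p3 * (if v = p3 then 1 else 0) * d v +
          d p3 * (if \<chi> \<and> v = q2 \<and> q2 = p3 then e1 * e2 * e3 else 0) * d v +
          d p3 * (if \<chi> \<and> v = q2 \<and> p3 < q2 then e1 * e2 * e3 else 0) * d v"
      proof -
        have Bp: "B p3 v = (if v = q2 \<and> \<chi> \<and> p3 < q2 then c p3 q2 * (e1 * e2 * e3) else 0)"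
          using ord by (auto simp: B_def)
        show ?thesis
        proof (cases p3 q2 rule: linorder_cases)
          case less
          then show ?thesis
            unfolding True D_def U_def Bp cd[OF less, symmetric] by (auto simp: cd[symmetric] mult_ac)
        next
          case equal
          then have "B p3 v = 0" unfolding Bp by simp
          then show ?thesis
            using equal unfolding True D_def U_def by (auto simp: algebra_simps)
        next
          case greater
          then have "B p3 v = 0" unfolding Bp by simp
          then show ?thesis
            using greater unfolding True D_def U_def by (auto simp: algebra_simps)
        qed
      qed
      show ?thesis
        unfolding sum q3 q1 q2 p3 using True ord
        by (cases p3 q2 rule: linorder_cases) (auto simp: algebra_simps)
    qed
  qed
  moreover have D: "\<delta> ^ (2 * a t) * (1 + (if t = p3 then if q3 = p1 \<and> q1 = p2 \<and> q2 = p3 then e1 * e2 * e3 else 0 else 0)) = D t" for t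
    by (simp only: D_def d_def \<chi>_def mult_2 power_add conj_assoc)
  moreover have "\<delta> dvd L u v - (if u = v then 1 else 0)" for u v
    using ord dc[of q3 p3] dc[of q1 p3] dc[of q2 p3]
    by (auto simp: L_def A_def A1_def A2_def A3_def intro!: dvd_add)
  moreover have "\<delta> dvd U u v - (if u = v then 1 else 0)" for u v
    using ord dc[of p1 q1] dc[of p2 q2] dc[of p3 q2] by (auto simp: U_def B_def)
  ultimately show thesis
    unfolding d_def by (intro that[of L U]) (simp_all only: D)
qed

text \<open>\<open>D\<close> is a derivation over \<open>c0\<close>, as \<open>c1\<close>,
  \<open>c2\<close> and \<open>c3\<close> are. This is why a first-order coordinate of any
  polynomial sees only its own perturbation direction.\<close>

lemma eval_mpoly_coord_cong:
  fixes h :: "'k::comm_ring_1 \<Rightarrow> 'b::comm_ring_1 dual3"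
  assumes h: "comm_ring_hom h"
    and der: "\<And>x y. D (x + y) = D x + D y" "\<And>x y. D (x * y) = c0 x * D y + D x * c0 y"
    and xy: "\<And>v. c0 (x v) = c0 (y v)" "\<And>v. D (x v) = D (y v)"
  shows "c0 (eval_mpoly h x p) = c0 (eval_mpoly h y p)" "D (eval_mpoly h x p) = (D (eval_mpoly h y p) :: 'b)"
proof -
  have "p \<in> polys_in UNIV" by (simp add: polys_in_def)
  then have "c0 (eval_mpoly h x p) = c0 (eval_mpoly h y p) \<and> D (eval_mpoly h x p) = D (eval_mpoly h y p)"
    by (induction p rule: polys_in_induct)
       (simp_all add: h eval_mpoly_add[OF h] eval_mpoly_mult[OF h] der xy coord_mult(1))
  then show "c0 (eval_mpoly h x p) = c0 (eval_mpoly h y p)" "D (eval_mpoly h x p) = D (eval_mpoly h y p)"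
    by blast+
qed

text \<open>The point is L T M T U with L, U specialised to constants and one entry of each block X,
  Y, Z of M marked by \<open>e1\<close>, \<open>e2\<close>, \<open>e3\<close>. The marks change a
  pivot, by their product, only if the three index pairs match; \<open>w\<close> is the weight of
  the leading monomial.\<close>

lemma det_ideal_degenerates_to_matmul:
  fixes f :: "(nat \<times> nat, 'a::field_char_0) mpoly"
  assumes f: "f \<in> det_ideal n m r" "f \<noteq> 0" and k: "3 * k \<le> r"
  obtains w :: nat and \<kappa> :: "nat \<Rightarrow> 'a" and x0 :: "nat \<times> nat \<Rightarrow> 'a poly"
    and x1 x2 x3 :: "nat \<times> nat \<Rightarrow> nat \<times> nat \<Rightarrow> 'a poly"
  where "\<And>l. l < k \<Longrightarrow> \<kappa> l \<noteq> 0"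
    and "\<And>i j j' l i' l'. i < k \<Longrightarrow> j < k \<Longrightarrow> j' < k \<Longrightarrow> l < k \<Longrightarrow> i' < k \<Longrightarrow> l' < k \<Longrightarrow>
      \<exists>q. c123 (eval_mpoly (\<lambda>c. scalar [:c:]) (\<lambda>v. scalar (x0 v) + scalar (x1 (i, j) v) * e1 +
          scalar (x2 (j', l) v) * e2 + scalar (x3 (i', l') v) * e3) f) =
        (if i' = i \<and> j' = j \<and> l' = l then monom (\<kappa> l') w else 0) + monom 1 (Suc w) * q"
proof -
  obtain \<Psi> :: "(nat, ((nat \<times> nat) + (nat \<times> nat), 'a) mpoly) mpoly" where \<Psi>: "\<Psi> \<noteq> 0"
    and supp: "\<And>t. t \<in> Poly_Mapping.keys \<Psi> \<Longrightarrow> Poly_Mapping.keys t \<subseteq> {..<n} \<and> r \<le> card (Poly_Mapping.keys t)"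
    and ev: "\<And>(h :: 'a \<Rightarrow> 'a poly dual3) l d u. comm_ring_hom h \<Longrightarrow>
      eval_mpoly (eval_mpoly h (case_sum l u)) d \<Psi> =
      eval_mpoly h (\<lambda>(i, j). \<Sum>t<n. l (i, t) * d t * u (t, j)) f"
    by (rule generic_diagonal_product[OF f]) blast
  obtain B where B: "B \<ge> 2" "inj_on (weight (\<lambda>t. B ^ t)) (Poly_Mapping.keys \<Psi>)"
    using separating_base[of "Poly_Mapping.keys \<Psi>" "\<lambda>t. t"] by auto
  define a where "a t = B ^ t" for t :: nat
  have mono: "strict_mono a" using B(1) by (auto simp: a_def strict_mono_def intro!: power_strict_increasing)
  \<comment> \<open>The factor 2 arises because T multiplies M from both sides.\<close>
  have weight2: "weight (\<lambda>t. 2 * a t) t = 2 * weight (\<lambda>t. B ^ t) t" for t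
    by (simp add: weight_def a_def sum_distrib_left mult_ac)
  have "Poly_Mapping.keys \<Psi> \<noteq> {}"
    using \<Psi> by (metis empty_iff in_keys_iff lookup_zero poly_mapping_eqI)
  then obtain \<alpha> where \<alpha>: "\<alpha> \<in> Poly_Mapping.keys \<Psi>"
      "\<And>\<beta>. \<beta> \<in> Poly_Mapping.keys \<Psi> \<Longrightarrow> weight (\<lambda>t. 2 * a t) \<alpha> \<le> weight (\<lambda>t. 2 * a t) \<beta>"
    using arg_min_if_finite[of "Poly_Mapping.keys \<Psi>" "weight (\<lambda>t. 2 * a t)"]
    by (meson finite_keys not_le)
  have \<alpha>_less: "weight (\<lambda>t. 2 * a t) \<alpha> < weight (\<lambda>t. 2 * a t) \<beta>"
    if "\<beta> \<in> Poly_Mapping.keys \<Psi>" "\<beta> \<noteq> \<alpha>" for \<beta>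
    using \<alpha>(2)[OF that(1)] inj_onD[OF B(2) _ that(1) \<alpha>(1)] that(2) unfolding weight2 by force
  define w where "w = weight (\<lambda>t. 2 * a t) \<alpha>"
  have "Poly_Mapping.lookup \<Psi> \<alpha> \<noteq> 0" using \<alpha>(1) by (simp add: in_keys_iff)
  from exists_eval_mpoly_nonzero[OF this]
  obtain x where x: "eval_mpoly (\<lambda>c. c) x (Poly_Mapping.lookup \<Psi> \<alpha>) \<noteq> 0" by blast
  define C where "C = eval_mpoly (\<lambda>c. c) x (Poly_Mapping.lookup \<Psi> \<alpha>)"
  \<comment> \<open>The support of \<open>\<alpha>\<close> in increasing order; its first
    \<open>3 * k\<close> members form three consecutive index blocks of M. The order places X and Y
    above the diagonal and Z below.\<close>
  define s where "s i = sorted_list_of_set (Poly_Mapping.keys \<alpha>) ! i" for i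
  have card: "3 * k \<le> card (Poly_Mapping.keys \<alpha>)" using supp[OF \<alpha>(1)] k by simp
  have s: "s i \<in> Poly_Mapping.keys \<alpha>" "s i < n" if "i < 3 * k" for i
  proof -
    have "s i \<in> set (sorted_list_of_set (Poly_Mapping.keys \<alpha>))"
      unfolding s_def by (rule nth_mem) (use card that in simp)
    then show "s i \<in> Poly_Mapping.keys \<alpha>" by simp
    then show "s i < n" using supp[OF \<alpha>(1)] by auto
  qed
  have s_less: "s i < s j" if "i < j" "j < 3 * k" for i j
    unfolding s_def by (rule sorted_wrt_nth_less[OF strict_sorted_list_of_set]) (use card that in auto)
  have s_eq: "s i = s j \<longleftrightarrow> i = j" if "i < 3 * k" "j < 3 * k" for i j
    using s_less[of i j] s_less[of j i] that by (cases i j rule: linorder_cases) auto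
  \<comment> \<open>The exponent comes from differentiating the monomial \<open>\<alpha>\<close> in
    the changed pivot; it is positive on the support, hence nonzero in characteristic zero.\<close>
  define \<kappa> where "\<kappa> l = C * of_nat (Poly_Mapping.lookup \<alpha> (s (2 * k + l)))" for l
  \<comment> \<open>The entry at \<open>(i, j)\<close> of L T E T U, where E is the matrix unit at
    \<open>(u, v)\<close>.\<close>
  define g where "g = (\<lambda>u v (i, j). monom (x (Inl (i, u)) * x (Inr (v, j))) (a u + a v))"
  define x0 where "x0 = (\<lambda>ij. \<Sum>t<n. g t t ij)"
  define x1 where "x1 = (\<lambda>(i, j). g (s i) (s (k + j)))"
  define x2 where "x2 = (\<lambda>(j, l). g (s (k + j)) (s (2 * k + l)))"
  define x3 where "x3 = (\<lambda>(i, l). g (s (2 * k + l)) (s i))"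
  have h: "comm_ring_hom (\<lambda>c :: 'a. scalar [:c:])"
    by (rule comm_ring_hom_compose[OF comm_ring_hom_const_poly comm_ring_hom_scalar])
  interpret S: comm_ring_hom "scalar :: 'a poly \<Rightarrow> _" by (rule comm_ring_hom_scalar)
  define \<delta> :: "'a poly dual3" where "\<delta> = scalar (monom 1 1)"
  have \<delta>_power: "\<delta> ^ N = scalar (monom 1 N)" for N
    unfolding \<delta>_def S.hom_power[symmetric] by (simp add: monom_power)
  show thesis
  proof (rule that[of \<kappa> x0 x1 x2 x3 w])
    fix l assume "l < k"
    then show "\<kappa> l \<noteq> 0" using x s(1)[of "2 * k + l"] by (simp add: \<kappa>_def C_def in_keys_iff)
  next
    fix i j j' l i' l' assume lt: "i < k" "j < k" "j' < k" "l < k" "i' < k" "l' < k"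
    define p1 where "p1 = s i"
    define q1 where "q1 = s (k + j)"
    define p2 where "p2 = s (k + j')"
    define q2 where "q2 = s (2 * k + l)"
    define p3 where "p3 = s (2 * k + l')"
    define q3 where "q3 = s i'"
    define e :: "'a poly dual3" where "e = (if q3 = p1 \<and> q1 = p2 \<and> q2 = p3 then e1 * e2 * e3 else 0)"
    have ord: "p1 < q1" "p1 < p2" "q3 < q1" "q3 < p2" "q1 < q2" "q1 < p3" "p2 < q2" "p2 < p3"
      using lt by (auto simp: p1_def p2_def p3_def q1_def q2_def q3_def intro!: s_less)
    have bound: "p1 < n" "p2 < n" "p3 < n" "q1 < n" "q2 < n" "q3 < n"
      using lt by (auto simp: p1_def p2_def p3_def q1_def q2_def q3_def intro!: s)
    have ee: "e * e = 0"
    proof -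
      have "(e1 * e2 * e3) * (e1 * e2 * e3) = (e1 * e1) * ((e2 * e2) * (e3 * e3 :: 'a poly dual3))"
        by (simp only: mult_ac)
      then show ?thesis by (simp add: e_def)
    qed
    obtain L U :: "nat \<Rightarrow> nat \<Rightarrow> 'a poly dual3" where
      L: "\<And>u v. \<delta> dvd L u v - (if u = v then 1 else 0)" and
      U: "\<And>u v. \<delta> dvd U u v - (if u = v then 1 else 0)" and
      LDU: "\<And>u v. u < n \<Longrightarrow> v < n \<Longrightarrow>
        (\<Sum>t<n. L u t * (\<delta> ^ (2 * a t) * (1 + (if t = p3 then e else 0))) * U t v) =
        \<delta> ^ a u * ((if u = v then 1 else 0) + (if u = p1 \<and> v = q1 then e1 else 0) +
          (if u = p2 \<and> v = q2 then e2 else 0) + (if u = p3 \<and> v = q3 then e3 else 0)) * \<delta> ^ a v"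
      unfolding e_def
      by (rule perturbed_identity_LDU[where \<delta> = \<delta>, OF mono e_squares ord bound(3,5)]) blast
    \<comment> \<open>The constant factors L and U absorb the conjugated unitriangular ones. Indices
      from \<open>n\<close> on keep their old values, so that the congruence with \<open>x\<close>
      holds at every variable.\<close>
    define lam where "lam = (\<lambda>(i, t). if t < n then \<Sum>u<n. scalar [:x (Inl (i, u)):] * L u t else scalar [:x (Inl (i, t)):])"
    define mu where "mu = (\<lambda>(t, j). if t < n then \<Sum>v<n. U t v * scalar [:x (Inr (v, j)):] else scalar [:x (Inr (t, j)):])"
    define y where "y = case_sum lam mu"
    let ?D = "\<lambda>t. \<delta> ^ (2 * a t) * (1 + (if t = p3 then e else 0))"
    have y: "\<delta> dvd y v - scalar [:x v:]" for v
    proof (cases v)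
      case (Inl it)
      obtain i t where it: "it = (i, t)" by fastforce
      have "lam (i, t) - scalar [:x (Inl (i, t)):] =
          (\<Sum>u<n. scalar [:x (Inl (i, u)):] * (L u t - (if u = t then 1 else 0)))" if "t < n"
        using that by (simp add: lam_def right_diff_distrib sum_subtractf if_distrib[of "\<lambda>x. _ * x"] cong: if_cong)
      then have "\<delta> dvd lam (i, t) - scalar [:x (Inl (i, t)):]"
        by (cases "t < n") (auto intro!: dvd_sum dvd_mult L simp: lam_def)
      then show ?thesis by (simp add: y_def Inl it)
    next
      case (Inr tj)
      obtain t j where tj: "tj = (t, j)" by fastforce
      have "mu (t, j) - scalar [:x (Inr (t, j)):] =
          (\<Sum>v<n. (U t v - (if t = v then 1 else 0)) * scalar [:x (Inr (v, j)):])" if "t < n"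
        using that by (simp add: mu_def left_diff_distrib sum_subtractf if_distrib[of "\<lambda>x. x * _"] cong: if_cong)
      then have "\<delta> dvd mu (t, j) - scalar [:x (Inr (t, j)):]"
        by (cases "t < n") (auto intro!: dvd_sum dvd_mult2 U simp: mu_def)
      then show ?thesis by (simp add: y_def Inr tj)
    qed
    let ?P = "\<lambda>v. scalar (x0 v) + scalar (x1 (i, j) v) * e1 + scalar (x2 (j', l) v) * e2 + scalar (x3 (i', l') v) * e3"
    \<comment> \<open>The absorbed factors around the diagonal matrix multiply back to the marked
      point L T M T U, so \<open>\<Psi>\<close> computes \<open>f\<close> there.\<close>
    have point: "(\<Sum>t<n. lam (r, t) * ?D t * mu (t, c)) = ?P (r, c)" for r c
    proof -
      let ?l = "\<lambda>u. scalar [:x (Inl (r, u)):]" and ?u = "\<lambda>v. scalar [:x (Inr (v, c)):]"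
      have "(\<Sum>t<n. lam (r, t) * ?D t * mu (t, c)) =
          (\<Sum>t<n. \<Sum>u<n. \<Sum>v<n. ?l u * (L u t * ?D t * U t v) * ?u v)"
        by (rule sum.cong) (simp_all add: lam_def mu_def sum_distrib_left sum_distrib_right mult_ac)
      also have "\<dots> = (\<Sum>u<n. \<Sum>t<n. \<Sum>v<n. ?l u * (L u t * ?D t * U t v) * ?u v)"
        by (rule sum.swap)
      also have "\<dots> = (\<Sum>u<n. \<Sum>v<n. \<Sum>t<n. ?l u * (L u t * ?D t * U t v) * ?u v)"
        by (rule sum.cong[OF refl], rule sum.swap)
      also have "\<dots> = (\<Sum>u<n. \<Sum>v<n. ?l u * (\<Sum>t<n. L u t * ?D t * U t v) * ?u v)"
        by (simp only: sum_distrib_left sum_distrib_right)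
      also have "\<dots> = (\<Sum>u<n. \<Sum>v<n. (if v = u then scalar (g u v (r, c)) else 0) +
          (if v = q1 then if u = p1 then scalar (g u v (r, c)) * e1 else 0 else 0) +
          (if v = q2 then if u = p2 then scalar (g u v (r, c)) * e2 else 0 else 0) +
          (if v = q3 then if u = p3 then scalar (g u v (r, c)) * e3 else 0 else 0))"
      proof (intro sum.cong refl)
        fix u v assume "u \<in> {..<n}" "v \<in> {..<n}"
        then have uv: "u < n" "v < n" by simp_all
        have G: "scalar (g u v (r, c)) = ?l u * \<delta> ^ a u * \<delta> ^ a v * ?u v"
          by (simp add: g_def \<delta>_power flip: S.hom_mult) (simp add: smult_monom mult_monom mult_ac)
        show "?l u * (\<Sum>t<n. L u t * ?D t * U t v) * ?u v = (if v = u then scalar (g u v (r, c)) else 0) +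
          (if v = q1 then if u = p1 then scalar (g u v (r, c)) * e1 else 0 else 0) +
          (if v = q2 then if u = p2 then scalar (g u v (r, c)) * e2 else 0 else 0) +
          (if v = q3 then if u = p3 then scalar (g u v (r, c)) * e3 else 0 else 0)"
          unfolding G LDU[OF uv] by (auto simp: algebra_simps)
      qed
      also have "\<dots> = ?P (r, c)"
        using bound by (simp add: sum.distrib x0_def x1_def x2_def x3_def S.hom_sum p1_def p2_def p3_def q1_def q2_def q3_def)
      finally show ?thesis .
    qed
    have eval_f: "eval_mpoly (eval_mpoly (\<lambda>c. scalar [:c:]) y) ?D \<Psi> = eval_mpoly (\<lambda>c. scalar [:c:]) ?P f"
      unfolding y_def ev[OF h] by (rule arg_cong2[of _ _ _ _ "eval_mpoly _"]) (auto simp: fun_eq_iff point)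
    have "\<delta> ^ Suc w dvd eval_mpoly (\<lambda>c. scalar [:c:]) ?P f -
        \<delta> ^ w * scalar [:C:] * (1 + of_nat (Poly_Mapping.lookup \<alpha> p3) * e)"
      unfolding w_def C_def eval_f[symmetric] by (rule leading_term[OF h \<alpha>(1) \<alpha>_less y ee])
    then obtain Q where Q: "eval_mpoly (\<lambda>c. scalar [:c:]) ?P f =
        \<delta> ^ Suc w * Q + \<delta> ^ w * scalar [:C:] * (1 + of_nat (Poly_Mapping.lookup \<alpha> p3) * e)"
      unfolding dvd_def diff_eq_eq by (elim exE)
    have c123_scalar: "c123 (scalar b * z) = b * c123 z" for b and z :: "'a poly dual3"
      by (simp add: coord_mult)
    have c123_e: "c123 e = (if i' = i \<and> j' = j \<and> l' = l then 1 else 0)"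
    proof -
      have "c123 (e1 * e2 * e3 :: 'a poly dual3) = 1" "c123 (0 :: 'a poly dual3) = 0"
        by (simp_all add: coord_mult, simp add: coord_defs)
      then show ?thesis
        using lt by (auto simp: e_def p1_def p2_def p3_def q1_def q2_def q3_def s_eq)
    qed
    have c123_1: "c123 (1 :: 'a poly dual3) = 0" by (simp add: coord_defs)
    have "c123 (eval_mpoly (\<lambda>c. scalar [:c:]) ?P f) =
        monom 1 w * ([:C:] * (of_nat (Poly_Mapping.lookup \<alpha> p3) * c123 e)) + monom 1 (Suc w) * c123 Q"
      unfolding Q \<delta>_power S.hom_of_nat[symmetric] mult.assoc coord_add c123_scalar c123_1 by simp
    also have "monom 1 w * ([:C:] * (of_nat (Poly_Mapping.lookup \<alpha> p3) * c123 e)) =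
        (if i' = i \<and> j' = j \<and> l' = l then monom (\<kappa> l') w else 0)"
      by (simp add: c123_e \<kappa>_def p3_def of_nat_poly smult_monom mult_ac)
    finally show "\<exists>q. c123 (eval_mpoly (\<lambda>c. scalar [:c:]) ?P f) =
        (if i' = i \<and> j' = j \<and> l' = l then monom (\<kappa> l') w else 0) + monom 1 (Suc w) * q" by blast
  qed
qed

section \<open>The lower bound\<close>

lemma map_mpoly_eq_eval_mpoly:
  assumes "comm_ring_hom c"
  shows "Poly_Mapping.map c p = eval_mpoly (\<lambda>x. Cst (c x)) Var p"
proof -
  interpret c: comm_ring_hom c by fact
  interpret Cst: comm_ring_hom Cst by (rule comm_ring_hom_Cst)
  show ?thesis
    using eval_mpoly_map[of c Cst Var p] by (simp add: eval_mpoly_Cst_Var)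
qed

lemma comm_ring_hom_to_fract: "comm_ring_hom to_fract"
  by standard simp_all

lemma of_base_alt: "of_base = eval_mpoly (\<lambda>c. Cst (to_fract [:c:])) Var"
  unfolding of_base_def to_fract_def[symmetric]
  by (rule ext, rule map_mpoly_eq_eval_mpoly)
     (rule comm_ring_hom_compose[OF comm_ring_hom_const_poly comm_ring_hom_to_fract])

lemma of_eps_poly_alt: "of_eps_poly = eval_mpoly (\<lambda>c. Cst (to_fract c)) Var"
  unfolding of_eps_poly_def to_fract_def[symmetric]
  by (rule ext, rule map_mpoly_eq_eval_mpoly) (rule comm_ring_hom_to_fract)

lemma polys_in_map:
  assumes "p \<in> polys_in V" "c 0 = 0"
  shows "Poly_Mapping.map c p \<in> polys_in V"
  using assms by (auto simp: polys_in_def in_keys_iff lookup_map_mpoly)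

text \<open>Some circuit computes \<open>f\<close> exactly, with error polynomial 0, so the minimum
  ranges over a nonempty set.\<close>

lemma border_mult_complexity_witness:
  fixes f :: "('v, 'a::field) mpoly"
  assumes "f \<in> polys_in V"
  obtains C :: "('v, 'a poly fract) circuit" and h where "circuit_over V C"
    "mult_complexity C = border_mult_complexity V f" "computes C h" "approximates V h f"
proof -
  have "of_base f \<in> polys_in V"
    unfolding of_base_def by (rule polys_in_map[OF assms]) (simp flip: to_fract_def)
  then obtain C where C: "circuit_over V C" "computes C (of_base f)"
    by (rule exists_circuit)
  have zero: "of_eps_poly 0 = (0 :: ('v, 'a poly fract) mpoly)"
    by (simp add: of_eps_poly_def map_eq_zero_iff)
  have "approximates V (of_base f) f"
    unfolding approximates_def
    by (rule bexI[of _ 0]) (simp_all add: zero polys_in_def)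
  with C have "\<exists>s. \<exists>(C :: ('v, 'a poly fract) circuit) h.
      circuit_over V C \<and> mult_complexity C = s \<and> computes C h \<and> approximates V h f"
    by blast
  from LeastI_ex[OF this] show thesis
    unfolding border_mult_complexity_def[symmetric] using that by blast
qed

text \<open>\<open>A\<close>, \<open>B\<close> and \<open>G\<close> hold the coefficients of the
  linear forms; comparing coefficients turns the approximation into one scalar condition per triple
  of index pairs.\<close>

lemma border_rank_matmul_le:
  fixes A B G :: "nat \<Rightarrow> nat \<times> nat \<Rightarrow> 'a::field poly fract"
  assumes "\<And>i j j' l i' l'. i < k \<Longrightarrow> j < k \<Longrightarrow> j' < k \<Longrightarrow> l < k \<Longrightarrow> i' < k \<Longrightarrow> l' < k \<Longrightarrow>
    \<exists>q. (\<Sum>t<s. A t (i, j) * B t (j', l) * G t (i', l')) =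
      (if i' = i \<and> j' = j \<and> l' = l then 1 else 0) + eps * to_fract q"
  shows "border_rank_matmul TYPE('a) k \<le> s"
proof -
  define K where "K = {..<k} \<times> {..<k}"
  \<comment> \<open>Choosing one error per triple lets the errors be assembled into the polynomial
    \<open>g\<close>.\<close>
  define q where "q a b c = (SOME q. (\<Sum>t<s. A t a * B t b * G t c) =
      (if c = (fst a, snd b) \<and> fst b = snd a then 1 else 0) + eps * to_fract q)" for a b c
  have q: "(\<Sum>t<s. A t a * B t b * G t c) =
      (if c = (fst a, snd b) \<and> fst b = snd a then 1 else 0) + eps * to_fract (q a b c)"
    if "a \<in> K" "b \<in> K" "c \<in> K" for a b c
  proof -
    have "c = (fst a, snd b) \<and> fst b = snd a \<longleftrightarrow> fst c = fst a \<and> fst b = snd a \<and> snd c = snd b"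
      by (auto simp: prod_eq_iff)
    then have "\<exists>q. (\<Sum>t<s. A t a * B t b * G t c) =
        (if c = (fst a, snd b) \<and> fst b = snd a then 1 else 0) + eps * to_fract q"
      using assms[of "fst a" "snd a" "fst b" "snd b" "fst c" "snd c"] that by (simp add: K_def mem_Times_iff)
    then show ?thesis unfolding q_def by (rule someI_ex)
  qed
  define X where "X = (\<lambda>a. XV (fst a) (snd a))"
  define Y where "Y = (\<lambda>a. YV (fst a) (snd a))"
  define Z where "Z = (\<lambda>a. ZV (fst a) (snd a))"
  have vars: "x_vars k = X ` K" "y_vars k = Y ` K" "z_vars k = Z ` K"
    by (force simp: x_vars_def y_vars_def z_vars_def K_def X_def Y_def Z_def)+
  have inj: "inj_on X K" "inj_on Y K" "inj_on Z K"
    by (auto simp: inj_on_def X_def Y_def Z_def prod_eq_iff)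
  let ?V = "x_vars k \<union> y_vars k \<union> z_vars k"
  define l1 where "l1 t = (\<Sum>a\<in>K. Cst (A t a) * Var (X a))" for t
  define l2 where "l2 t = (\<Sum>b\<in>K. Cst (B t b) * Var (Y b))" for t
  define l3 where "l3 t = (\<Sum>c\<in>K. Cst (G t c) * Var (Z c))" for t
  have lin: "(\<Sum>a\<in>K. Cst (c a) * Var (X' a)) \<in> linear_forms (X' ` K)" if "inj_on X' K"
    for c :: "nat \<times> nat \<Rightarrow> 'a poly fract" and X' :: "nat \<times> nat \<Rightarrow> mm_var"
    unfolding linear_forms_def
    by (rule CollectI, rule exI[of _ "\<lambda>v. c (inv_into K X' v)"])
       (simp add: sum.reindex[OF that] inv_into_f_f[OF that])
  interpret Cst: comm_ring_hom "Cst :: _ \<Rightarrow> (mm_var, 'a poly fract) mpoly" by (rule comm_ring_hom_Cst)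
  define g :: "(mm_var, 'a poly) mpoly" where
    "g = (\<Sum>a\<in>K. \<Sum>b\<in>K. \<Sum>c\<in>K. Cst (q a b c) * (Var (X a) * Var (Y b) * Var (Z c)))"
  have g: "g \<in> polys_in ?V"
    unfolding g_def vars by (intro polys_in_sum polys_in_mult polys_in_Cst polys_in_Var) auto
  have hb: "comm_ring_hom (\<lambda>c :: 'a. Cst (to_fract [:c:]) :: (mm_var, 'a poly fract) mpoly)"
    by (rule comm_ring_hom_compose[OF comm_ring_hom_compose[OF comm_ring_hom_const_poly comm_ring_hom_to_fract] comm_ring_hom_Cst])
  have he: "comm_ring_hom (\<lambda>c :: 'a poly. Cst (to_fract c) :: (mm_var, 'a poly fract) mpoly)"
    by (rule comm_ring_hom_compose[OF comm_ring_hom_to_fract comm_ring_hom_Cst])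
  let ?XYZ = "\<lambda>a b c. Var (X a) * Var (Y b) * Var (Z c) :: (mm_var, 'a poly fract) mpoly"
  have base: "of_base (matmul_tensor k :: (mm_var, 'a) mpoly) =
      (\<Sum>a\<in>K. \<Sum>b\<in>K. \<Sum>c\<in>K. Cst (if c = (fst a, snd b) \<and> fst b = snd a then 1 else 0) * ?XYZ a b c)"
  proof -
    have "(\<Sum>a\<in>K. \<Sum>b\<in>K. \<Sum>c\<in>K. Cst (if c = (fst a, snd b) \<and> fst b = snd a then 1 else 0) * ?XYZ a b c) =
        (\<Sum>a\<in>K. \<Sum>b\<in>K. if fst b = snd a then ?XYZ a b (fst a, snd b) else 0)"
    proof (intro sum.cong refl)
      fix a b assume ab: "a \<in> K" "b \<in> K"
      have "(\<Sum>c\<in>K. Cst (if c = (fst a, snd b) \<and> fst b = snd a then 1 else 0) * ?XYZ a b c) =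
          (\<Sum>c\<in>K. if c = (fst a, snd b) then if fst b = snd a then ?XYZ a b c else 0 else 0)"
        by (rule sum.cong) auto
      also have "\<dots> = (if fst b = snd a then ?XYZ a b (fst a, snd b) else 0)"
        using ab by (auto simp: K_def)
      finally show "(\<Sum>c\<in>K. Cst (if c = (fst a, snd b) \<and> fst b = snd a then 1 else 0) * ?XYZ a b c) =
        (if fst b = snd a then ?XYZ a b (fst a, snd b) else 0)" .
    qed
    also have "\<dots> = (\<Sum>i<k. \<Sum>j<k. \<Sum>j'<k. \<Sum>l<k. if j' = j then ?XYZ (i, j) (j', l) (i, l) else 0)"
      by (simp add: K_def sum.cartesian_product' cong: if_cong)
    also have "\<dots> = (\<Sum>i<k. \<Sum>j<k. \<Sum>j'<k. if j' = j then \<Sum>l<k. ?XYZ (i, j) (j', l) (i, l) else 0)"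
      by (intro sum.cong refl) auto
    also have "\<dots> = (\<Sum>i<k. \<Sum>j<k. \<Sum>l<k. ?XYZ (i, j) (j, l) (i, l))"
      by simp
    also have "\<dots> = of_base (matmul_tensor k)"
      by (simp add: of_base_alt matmul_tensor_def eval_mpoly_sum[OF hb] eval_mpoly_mult[OF hb]
          eval_mpoly_Var[OF hb] X_def Y_def Z_def)
    finally show ?thesis ..
  qed
  have "(\<Sum>t<s. l1 t * l2 t * l3 t) =
      (\<Sum>t<s. \<Sum>a\<in>K. \<Sum>b\<in>K. \<Sum>c\<in>K. Cst (A t a * B t b * G t c) * ?XYZ a b c)"
    unfolding l1_def sum_distrib_right unfolding l2_def sum_distrib_left sum_distrib_right
    unfolding l3_def sum_distrib_left
    by (simp only: Cst.hom_mult mult_ac)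
  also have "\<dots> = (\<Sum>a\<in>K. \<Sum>b\<in>K. \<Sum>c\<in>K. \<Sum>t<s. Cst (A t a * B t b * G t c) * ?XYZ a b c)"
    by (subst sum.swap, intro sum.cong refl, subst sum.swap, intro sum.cong refl, rule sum.swap)
  also have "\<dots> = (\<Sum>a\<in>K. \<Sum>b\<in>K. \<Sum>c\<in>K. Cst (\<Sum>t<s. A t a * B t b * G t c) * ?XYZ a b c)"
    by (simp only: Cst.hom_sum sum_distrib_right)
  also have "\<dots> = (\<Sum>a\<in>K. \<Sum>b\<in>K. \<Sum>c\<in>K. Cst (if c = (fst a, snd b) \<and> fst b = snd a then 1 else 0) * ?XYZ a b c +
      Cst eps * (Cst (to_fract (q a b c)) * ?XYZ a b c))"
    by (intro sum.cong refl) (simp only: q Cst.hom_add Cst.hom_mult distrib_right, simp only: mult.assoc)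
  also have "\<dots> = of_base (matmul_tensor k) + Cst eps * of_eps_poly g"
    unfolding base of_eps_poly_alt g_def eval_mpoly_sum[OF he] eval_mpoly_mult[OF he]
      eval_mpoly_Var[OF he] eval_mpoly_Cst[OF he] sum_distrib_left sum.distrib ..
  finally have "approximates ?V (\<Sum>t<s. l1 t * l2 t * l3 t) (matmul_tensor k :: (mm_var, 'a) mpoly)"
    unfolding approximates_def using g by blast
  moreover have "\<forall>t<s. l1 t \<in> linear_forms (x_vars k) \<and> l2 t \<in> linear_forms (y_vars k) \<and> l3 t \<in> linear_forms (z_vars k)"
    unfolding l1_def l2_def l3_def vars by (auto intro!: lin inj)
  ultimately show ?thesis
    unfolding border_rank_matmul_def by (intro Least_le exI conjI) auto
qed

text \<open>The trilinear part of an optimal border circuit at the degenerating point is read in two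
  ways: as six products per multiplication gate, and as a weighted matrix multiplication tensor
  times \<epsilon>^w up to higher order.\<close>

lemma border_rank_matmul_le_border_mult_complexity:
  fixes f :: "(nat \<times> nat, 'a::field_char_0) mpoly"
  assumes f: "f \<in> det_ideal n m r" "f \<noteq> 0" and k: "3 * k \<le> r"
  shows "border_rank_matmul TYPE('a) k \<le> 6 * border_mult_complexity (matrix_vars n m) f"
proof -
  have "f \<in> polys_in (matrix_vars n m)" using f(1) det_ideal_subset_polys_in by auto
  then obtain C :: "(nat \<times> nat, 'a poly fract) circuit" and h where
    C: "circuit_over (matrix_vars n m) C" "computes C h"
    and compl: "mult_complexity C = border_mult_complexity (matrix_vars n m) f"
    and appr: "approximates (matrix_vars n m) h f"
    by (rule border_mult_complexity_witness)
  obtain g where h: "h = of_base f + Cst eps * of_eps_poly g"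
    using appr by (auto simp: approximates_def)
  obtain w \<kappa> x0 x1 x2 x3 where \<kappa>: "\<And>l. l < k \<Longrightarrow> \<kappa> l \<noteq> (0 :: 'a)"
    and f_eval: "\<And>i j j' l i' l'. i < k \<Longrightarrow> j < k \<Longrightarrow> j' < k \<Longrightarrow> l < k \<Longrightarrow> i' < k \<Longrightarrow> l' < k \<Longrightarrow>
      \<exists>q. c123 (eval_mpoly (\<lambda>c. scalar [:c:]) (\<lambda>v. scalar (x0 v) + scalar (x1 (i, j) v) * e1 +
          scalar (x2 (j', l) v) * e2 + scalar (x3 (i', l') v) * e3) f) =
        (if i' = i \<and> j' = j \<and> l' = l then monom (\<kappa> l') w else 0) + monom 1 (Suc w) * q"
    by (rule det_ideal_degenerates_to_matmul[OF f k]) blast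
  define P where "P a b c v = scalar (x0 v) + scalar (x1 a v) * e1 + scalar (x2 b v) * e2 + scalar (x3 c v) * e3"
    for a b c v
  interpret \<iota>: comm_ring_hom "map3 to_fract :: 'a poly dual3 \<Rightarrow> _"
    by (rule comm_ring_hom_map3[OF comm_ring_hom_to_fract])
  have P': "map3 to_fract (P a b c v) = scalar (to_fract (x0 v)) + scalar (to_fract (x1 a v)) * e1 +
      scalar (to_fract (x2 b v)) * e2 + scalar (to_fract (x3 c v)) * e3" for a b c v
    by (simp add: P_def \<iota>.hom_add \<iota>.hom_mult map3_e)
  text \<open>Replacing \<open>\<epsilon>\<close> by \<open>\<epsilon>^(w + 1)\<close> in the circuit makes its error term negligible after the
    substitution, which scales the leading part of \<open>f\<close> by \<open>\<epsilon>^w\<close>.\<close>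
  define \<phi> where "\<phi> = (subst_eps (Suc w) :: 'a poly fract \<Rightarrow> _)"
  have \<phi>: "comm_ring_hom (\<lambda>x. scalar (\<phi> x))"
    unfolding \<phi>_def by (rule comm_ring_hom_compose[OF comm_ring_hom_subst_eps comm_ring_hom_scalar]) simp
  interpret \<phi>: comm_ring_hom "\<lambda>x. scalar (\<phi> x)" by (rule \<phi>)
  \<comment> \<open>Only the coefficients pass through \<open>\<phi>\<close>; the point keeps its
    own \<epsilon>, so the leading part stays at order \<open>w\<close> while the circuit error
    starts at order \<open>w + 1\<close>.\<close>
  define H where "H a b c = eval_mpoly (\<lambda>x. scalar (\<phi> x)) (\<lambda>v. map3 to_fract (P a b c v))" for a b c
  have H: "comm_ring_hom (H a b c)" for a b c
    unfolding H_def by (rule comm_ring_hom_eval_mpoly[OF \<phi>])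
  note coord = eval_mpoly_coord_cong[OF \<phi>]
  \<comment> \<open>A dummy direction, filling the positions on which a coordinate does not
    depend.\<close>
  define o' where "o' = (0 :: nat, 0 :: nat)"
  have c: "c0 (H a b c x) = c0 (H o' o' o' x)" "c1 (H a b c x) = c1 (H a o' o' x)"
    "c2 (H a b c x) = c2 (H o' b o' x)" "c3 (H a b c x) = c3 (H o' o' c x)" for a b c x
    unfolding H_def
    by (rule coord(1)[of "\<lambda>_. 0"] coord(2)[of c1] coord(2)[of c2] coord(2)[of c3]; simp add: P' coord_mult)+
  obtain A B G where ABG: "\<And>a b c. c123 (H a b c h) = (\<Sum>t<6 * mult_complexity C. A t a * B t b * G t c)"
  proof (rule circuit_trilinear_part[where H = H, OF C H _ _ c])
    show "H a b c (Cst x) = scalar (\<phi> x)" for a b c x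
      by (simp add: H_def eval_mpoly_Cst[OF \<phi>])
    show "c12 (H a b c (Var v)) = 0 \<and> c13 (H a b c (Var v)) = 0 \<and>
        c23 (H a b c (Var v)) = 0 \<and> c123 (H a b c (Var v)) = 0" for a b c v
      by (simp add: H_def eval_mpoly_Var[OF \<phi>] P' coord_mult)
  qed blast
  have \<phi>_to_fract: "\<phi> (to_fract p) = to_fract (pcompose p (monom 1 (Suc w)))" for p
    by (simp add: \<phi>_def subst_eps_to_fract)
  have c123_scalar: "c123 (scalar b * z) = b * c123 z" for b :: "'a poly fract" and z
    by (simp add: coord_mult)
  have H_h: "c123 (H a b c h) = to_fract (c123 (eval_mpoly (\<lambda>c. scalar [:c:]) (P a b c) f) +
      monom 1 (Suc w) * c123 (eval_mpoly (\<lambda>p. scalar (pcompose p (monom 1 (Suc w)))) (P a b c) g))" for a b c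
  proof -
    have "H a b c (of_base f) = map3 to_fract (eval_mpoly (\<lambda>c. scalar [:c:]) (P a b c) f)"
      unfolding H_def of_base_def to_fract_def[symmetric] hom_eval_mpoly[OF \<iota>.comm_ring_hom_axioms]
      by (subst eval_mpoly_map) (simp_all add: \<phi>_to_fract \<phi>.hom_zero)
    moreover have "H a b c (of_eps_poly g) = map3 to_fract
        (eval_mpoly (\<lambda>p. scalar (pcompose p (monom 1 (Suc w)))) (P a b c) g)"
      unfolding H_def of_eps_poly_def to_fract_def[symmetric] hom_eval_mpoly[OF \<iota>.comm_ring_hom_axioms]
      by (subst eval_mpoly_map) (simp_all add: \<phi>_to_fract \<phi>.hom_zero)
    moreover have "H a b c (Cst eps) = scalar (to_fract (monom 1 (Suc w)))"
      by (simp add: H_def eval_mpoly_Cst[OF \<phi>] eps_def \<phi>_to_fract pcompose_pCons flip: to_fract_def)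
    ultimately show ?thesis
      unfolding h H_def eval_mpoly_add[OF \<phi>] eval_mpoly_mult[OF \<phi>]
      unfolding H_def[symmetric] by (simp add: c123_scalar)
  qed
  show ?thesis
    unfolding compl[symmetric]
  \<comment> \<open>The weight \<open>\<kappa> l\<close> depends only on an index of the third
    factor, so it can be divided out there together with the power of \<epsilon>.\<close>
  proof (rule border_rank_matmul_le[where A = A and B = B and G = "\<lambda>t (i, l). G t (i, l) / to_fract (monom (\<kappa> l) w)"])
    fix i j j' l i' l' assume lt: "i < k" "j < k" "j' < k" "l < k" "i' < k" "l' < k"
    from f_eval[OF lt] obtain q where
      q: "c123 (eval_mpoly (\<lambda>c. scalar [:c:]) (P (i, j) (j', l) (i', l')) f) =
        (if i' = i \<and> j' = j \<and> l' = l then monom (\<kappa> l') w else 0) + monom 1 (Suc w) * q"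
      unfolding P_def by blast
    define q' where "q' = q + c123 (eval_mpoly (\<lambda>p. scalar (pcompose p (monom 1 (Suc w)))) (P (i, j) (j', l) (i', l')) g)"
    let ?m = "to_fract (monom (\<kappa> l') w)"
    have m: "?m \<noteq> 0" using \<kappa>[OF lt(6)] by simp
    have "monom 1 (Suc w) * q' = monom (\<kappa> l') w * ([:0, 1:] * smult (inverse (\<kappa> l')) q')"
    proof -
      have "[:0, 1:] = (monom 1 1 :: 'a poly)" by (simp add: monom_Suc)
      then have "monom (\<kappa> l') w * ([:0, 1:] * smult (inverse (\<kappa> l')) q') =
          smult (inverse (\<kappa> l')) (monom (\<kappa> l') w * monom 1 1) * q'"
        by (simp add: mult.assoc)
      also have "\<dots> = monom 1 (Suc w) * q'"
        using \<kappa>[OF lt(6)] by (simp add: mult_monom smult_monom)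
      finally show ?thesis ..
    qed
    then have fr: "to_fract (monom 1 (Suc w) * q') = ?m * (eps * to_fract (smult (inverse (\<kappa> l')) q'))"
      by (simp only: to_fract_mult eps_def to_fract_def[symmetric])
    have "(\<Sum>t<6 * mult_complexity C. A t (i, j) * B t (j', l) * (case (i', l') of (i, l) \<Rightarrow> G t (i, l) / to_fract (monom (\<kappa> l) w))) =
        c123 (H (i, j) (j', l) (i', l') h) / ?m"
      unfolding ABG by (simp add: sum_divide_distrib)
    also have "\<dots> = to_fract ((if i' = i \<and> j' = j \<and> l' = l then monom (\<kappa> l') w else 0) + monom 1 (Suc w) * q') / ?m"
      unfolding H_h q q'_def by (simp add: distrib_left add.assoc)
    also have "\<dots> = (if i' = i \<and> j' = j \<and> l' = l then 1 else 0) + eps * to_fract (smult (inverse (\<kappa> l')) q')"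
      unfolding to_fract_add fr using m \<kappa>[OF lt(4)] by (simp add: add_divide_distrib)
    finally show "\<exists>q. (\<Sum>t<6 * mult_complexity C. A t (i, j) * B t (j', l) *
        (case (i', l') of (i, l) \<Rightarrow> G t (i, l) / to_fract (monom (\<kappa> l) w))) =
        (if i' = i \<and> j' = j \<and> l' = l then 1 else 0) + eps * to_fract q" by blast
  qed
qed

theorem theorem3p4:
  fixes n m r :: nat
    and f :: "(nat \<times> nat, 'a::field_char_0) mpoly"
  assumes "f \<in> det_ideal n m r"
    and "f \<noteq> 0"
  shows "real (border_mult_complexity (matrix_vars n m) f)
           \<ge> 1 / 6 * real (border_rank_matmul TYPE('a) (r div 4))"
proof -
  have "3 * (r div 4) \<le> r" by linarith
  from border_rank_matmul_le_border_mult_complexity[OF assms this]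
  show ?thesis by linarith
qed

end
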